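(* There is a constant $c$ such that the following holds. Let $n,k$ be natural numbers and let $P\subseteq\mathbb{N}^2$ be an upward closed set such that $(0,n)\in P$, $(k,0)\in P$, $(a,b+c')\in P\Rightarrow(a+c',b)\in P$ for all $a,b,c'\in\mathbb{N}$, and $(a,b)\in P\Rightarrow a+b\ge k$. Then there is a string $x$ of length $n$ with $|C(x)-k|\le c\log n$ such that $x$ is $(c\log n,\ c\sqrt{n\log n})$-normal and the profile $P_x$ is $\bigl(C(P)+c\sqrt{n\log n}\bigr)$-close to $P$.
   Context: Strings are binary. $C(x\mid y)$ is the (plain) conditional Kolmogorov complexity with respect to a fixed universal decompressor $D$, $C(x)=C(x\mid\Lambda)$ ($\Lambda$ the empty string); finite sets and other finite objects have complexity defined via a fixed computable encoding $A\mapsto[A]$ into strings. The total conditional complexity $CT(y\mid x)$ is the minimal length of a program $p$ such that $D(p,z)$ is defined for every string $z$ and $D(p,x)=y$. A model (statistic) for $x$ is a finite set $A\ni x$. The profile of $x$ is $P_x=\{(a,b)\in\mathbb{N}^2:\exists A\ni x,\ C(A)\le a,\ \log_2|A|\le b\}$. The $\epsilon$-strong profile is $P_x^{\epsilon}=\{(a,b):\exists A\ni x,\ CT(A\mid x)\le\epsilon,\ C(A)\le a,\ \log_2|A|\le b\}$. A string $x$ is $(\epsilon,\delta)$-normal if $(a,b)\in P_x$ implies $(a+\delta,b+\delta)\in P_x^{\epsilon}$ for all $a,b$. Two subsets of $\mathbb{N}^2$ are $\varepsilon$-close if each lies in the $\varepsilon$-neighbourhood of the other. $C(P)$ denotes the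 Kolmogorov complexity of the boundary of $P$ (a finite object).
   Formalization: The theorem is stated for n at least 2: for n = 0 log n is undefined, and for n = 1 the bound c log n is 0, so |C(x)-k| ≤ 0 would force C(x) = k exactly, which fails for some universal decompressors. *)

theory Defs
  imports Complex_Main
begin

datatype recf = Zf | Sf | Proj nat | Comp recf "recf list" | Prec recf recf | Mn recf

inductive eval :: "recf \<Rightarrow> nat list \<Rightarrow> nat \<Rightarrow> bool" where
  eval_Z: "eval Zf xs 0"
| eval_S: "eval Sf (x # xs) (Suc x)"
| eval_Proj: "i < length xs \<Longrightarrow> eval (Proj i) xs (xs ! i)"
| eval_Comp: "length ys = length gs \<Longrightarrow> (\<forall>i < length gs. eval (gs ! i) xs (ys ! i))
     \<Longrightarrow> eval f ys z \<Longrightarrow> eval (Comp f gs) xs z"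
| eval_Prec0: "eval g xs z \<Longrightarrow> eval (Prec g h) (0 # xs) z"
| eval_PrecS: "eval (Prec g h) (n # xs) y \<Longrightarrow> eval h (n # y # xs) z
     \<Longrightarrow> eval (Prec g h) (Suc n # xs) z"
| eval_Mn: "eval f (n # xs) 0 \<Longrightarrow> (\<forall>m < n. \<exists>y. y > 0 \<and> eval f (m # xs) y)
     \<Longrightarrow> eval (Mn f) xs n"

section \<open>Binary strings and natural numbers (bijective base-2 numeration)\<close>

fun s2n :: "bool list \<Rightarrow> nat" where
  "s2n [] = 0"
| "s2n (b # bs) = 2 * s2n bs + (if b then 2 else 1)"

fun n2s :: "nat \<Rightarrow> bool list" where
  "n2s 0 = []"
| "n2s (Suc m) = odd m # n2s (m div 2)"

definition computable2 :: "(bool list \<Rightarrow> bool list \<Rightarrow> bool list option) \<Rightarrow> bool" where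
  "computable2 F \<longleftrightarrow> (\<exists>f. \<forall>p y z. eval f [s2n p, s2n y] z \<longleftrightarrow> F p y = Some (n2s z))"

definition universal :: "(bool list \<Rightarrow> bool list \<Rightarrow> bool list option) \<Rightarrow> bool" where
  "universal D \<longleftrightarrow> computable2 D \<and>
     (\<forall>F. computable2 F \<longrightarrow> (\<exists>c::nat. \<forall>p. \<exists>p'. length p' \<le> length p + c \<and> (\<forall>z. D p' z = F p z)))"

definition KC :: "(bool list \<Rightarrow> bool list \<Rightarrow> bool list option) \<Rightarrow> bool list \<Rightarrow> bool list \<Rightarrow> nat" where
  "KC D y x = (LEAST l. \<exists>p. length p = l \<and> D p x = Some y)"

definition CT :: "(bool list \<Rightarrow> bool list \<Rightarrow> bool list option) \<Rightarrow> bool list \<Rightarrow> bool list \<Rightarrow> nat" where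
  "CT D y x = (LEAST l. \<exists>p. length p = l \<and> (\<forall>z. D p z \<noteq> None) \<and> D p x = Some y)"

definition enc_set :: "bool list set \<Rightarrow> bool list" where
  "enc_set A = n2s (\<Sum>s\<in>A. 2 ^ s2n s)"

fun enc_nats :: "nat list \<Rightarrow> bool list" where
  "enc_nats [] = []"
| "enc_nats (m # ms) = replicate m True @ [False] @ enc_nats ms"

definition boundary :: "(nat \<times> nat) set \<Rightarrow> nat list" where
  "boundary P = map (\<lambda>b. LEAST a. (a, b) \<in> P) [0..<Suc (LEAST b. (0, b) \<in> P)]"

definition enc_bnd :: "(nat \<times> nat) set \<Rightarrow> bool list" where
  "enc_bnd P = enc_nats (boundary P)"

definition upward_closed :: "(nat \<times> nat) set \<Rightarrow> bool" where
  "upward_closed P \<longleftrightarrow> (\<forall>a b a' b'. (a, b) \<in> P \<and> a \<le> a' \<and> b \<le> b' \<longrightarrow> (a', b') \<in> P)"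

definition profile :: "(bool list \<Rightarrow> bool list \<Rightarrow> bool list option) \<Rightarrow> bool list \<Rightarrow> (nat \<times> nat) set" where
  "profile D x = {(a, b). \<exists>A. finite A \<and> x \<in> A \<and> KC D (enc_set A) [] \<le> a
                              \<and> log 2 (real (card A)) \<le> real b}"

definition in_strong_profile :: "(bool list \<Rightarrow> bool list \<Rightarrow> bool list option) \<Rightarrow> real \<Rightarrow> bool list
    \<Rightarrow> real \<Rightarrow> real \<Rightarrow> bool" where
  "in_strong_profile D eps x a b \<longleftrightarrow> (\<exists>A. finite A \<and> x \<in> A \<and> real (CT D (enc_set A) x) \<le> eps
        \<and> real (KC D (enc_set A) []) \<le> a \<and> log 2 (real (card A)) \<le> b)"

definition strong_profile :: "(bool list \<Rightarrow> bool list \<Rightarrow> bool list option) \<Rightarrow> real \<Rightarrow> bool list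
    \<Rightarrow> (nat \<times> nat) set" where
  "strong_profile D eps x = {(a, b). in_strong_profile D eps x (real a) (real b)}"

definition normal :: "(bool list \<Rightarrow> bool list \<Rightarrow> bool list option) \<Rightarrow> real \<Rightarrow> real \<Rightarrow> bool list \<Rightarrow> bool" where
  "normal D eps delta x \<longleftrightarrow> (\<forall>a b. (a, b) \<in> profile D x \<longrightarrow>
        in_strong_profile D eps x (real a + delta) (real b + delta))"

definition close :: "real \<Rightarrow> (nat \<times> nat) set \<Rightarrow> (nat \<times> nat) set \<Rightarrow> bool" where
  "close eps P Q \<longleftrightarrow>
     (\<forall>(a, b) \<in> P. \<exists>(a', b') \<in> Q. \<bar>real a - real a'\<bar> \<le> eps \<and> \<bar>real b - real b'\<bar> \<le> eps) \<and>
     (\<forall>(a, b) \<in> Q. \<exists>(a', b') \<in> P. \<bar>real a - real a'\<bar> \<le> eps \<and> \<bar>real b - real b'\<bar> \<le> eps)"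

end

(* The strong models are the sets of all strings of length n sharing a prescribed block of most
   significant bits with x (a suffix of the list, in the numeration of Defs). Such a set is obtained
   from x by a total program of O(log n) bits, so it is enough to build x in such a way that the
   complexities of these blocks follow the boundary f of P, while no set A containing x has
   log |A| <= b and complexity well below f b.

   Enumerate all sets violating this second condition and play a game: keep a leaf of the binary tree,
   abandon a node once too large a fraction of its leaves is covered by enumerated sets, and move to
   nodes with a smaller covered fraction below the lowest ancestor that is still admissible. A node of
   height b changes either because of sets with more than 2^b elements, of which there are few, or
   because of many small sets, whose total volume is bounded; this limits the number of changes to
   about 2^(f b). As the game is computable, the number of changes bounds the complexity of the final
   node. The game needs a description of f, which is affordable only after sampling f at about
   sqrt (n / log n) points. This is where the error sqrt (n log n) comes from. *)
theory Submission
  imports Defs "HOL-Library.Nat_Bijection"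
begin

section \<open>Total computable functions on lists of fixed length\<close>

text \<open>The error sqrt (n log n) must not enter C(x), although the description \<open>Q\<close>
  of the sampled boundary adds up to about \<open>2 * L\<close> bits to the complexity of the final
  leaf. So the levels of the game are lowered by \<open>2 * L\<close>, which cuts the number of
  changes of the leaf to about 2^(k - 2L) and makes room for \<open>Q\<close>. In return the leaf
  fixes only \<open>n - S\<close> bits of x, where \<open>S\<close> is \<open>2 * L\<close> (or
  \<open>n\<close> if that is smaller). A leaf all of whose extensions have complexity below
  \<open>l\<close>, which is k minus a logarithmic term, counts as covered too; each such leaf uses
  up 2^S short programs, so these leaves are few enough not to disturb the count. On the surviving
  leaf some extension therefore has complexity at least \<open>l\<close>. The first extension has
  complexity at most k + O(log n) and neighbouring extensions differ by a constant, so the first one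
  to reach \<open>l\<close> has complexity k up to O(log n), and this is x.\<close>

lemma eval_Zf_iff: "eval Zf xs z \<longleftrightarrow> z = 0"
  by (auto intro: eval_Z elim: eval.cases)

lemma eval_Sf_iff: "eval Sf xs z \<longleftrightarrow> (\<exists>x ys. xs = x # ys \<and> z = Suc x)"
  by (auto intro: eval_S elim: eval.cases)

lemma eval_Proj_iff: "eval (Proj i) xs z \<longleftrightarrow> i < length xs \<and> z = xs ! i"
  by (auto intro: eval_Proj elim: eval.cases)

lemma eval_Comp_iff:
  "eval (Comp f gs) xs z \<longleftrightarrow>
     (\<exists>ys. length ys = length gs \<and> (\<forall>i < length gs. eval (gs ! i) xs (ys ! i)) \<and> eval f ys z)"
  by (auto intro: eval_Comp elim: eval.cases)

lemma eval_Prec_0_iff: "eval (Prec g h) (0 # xs) z \<longleftrightarrow> eval g xs z"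
  by (auto intro: eval_Prec0 elim: eval.cases)

lemma eval_Prec_Suc_iff:
  "eval (Prec g h) (Suc n # xs) z \<longleftrightarrow> (\<exists>y. eval (Prec g h) (n # xs) y \<and> eval h (n # y # xs) z)"
  by (auto intro: eval_PrecS elim: eval.cases)

lemma eval_Mn_iff:
  "eval (Mn f) xs n \<longleftrightarrow> eval f (n # xs) 0 \<and> (\<forall>m<n. \<exists>y. y > 0 \<and> eval f (m # xs) y)"
  by (auto intro: eval_Mn elim: eval.cases)

text \<open>Nothing is asked of lists of other lengths, so \<open>F\<close> may be rewritten under
  the hypothesis \<open>length xs = n\<close>, as \<open>total_comp_cong\<close> does.\<close>

definition total_comp :: "nat \<Rightarrow> (nat list \<Rightarrow> nat) \<Rightarrow> bool" where
  "total_comp n F \<longleftrightarrow> (\<exists>r. \<forall>xs. length xs = n \<longrightarrow> (\<forall>z. eval r xs z \<longleftrightarrow> z = F xs))"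

lemma total_comp_cong: "(\<And>xs. length xs = n \<Longrightarrow> F xs = G xs) \<Longrightarrow> total_comp n F \<longleftrightarrow> total_comp n G"
  unfolding total_comp_def by (intro ex_cong1 all_cong1) auto

lemma total_comp_comp_list:
  assumes "total_comp (length Gs) F" "\<And>G. G \<in> set Gs \<Longrightarrow> total_comp n G"
  shows "total_comp n (\<lambda>xs. F (map (\<lambda>G. G xs) Gs))"
proof -
  obtain f where f: "\<And>xs z. length xs = length Gs \<Longrightarrow> eval f xs z \<longleftrightarrow> z = F xs"
    using assms(1) unfolding total_comp_def by blast
  have "\<forall>G\<in>set Gs. \<exists>r. \<forall>xs. length xs = n \<longrightarrow> (\<forall>z. eval r xs z \<longleftrightarrow> z = G xs)"
    using assms(2) unfolding total_comp_def by blast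
  then obtain r where r: "\<And>G xs z. G \<in> set Gs \<Longrightarrow> length xs = n \<Longrightarrow> eval (r G) xs z \<longleftrightarrow> z = G xs"
    by metis
  have "eval (Comp f (map r Gs)) xs z \<longleftrightarrow> z = F (map (\<lambda>G. G xs) Gs)" if "length xs = n" for xs z
  proof -
    have "eval (Comp f (map r Gs)) xs z \<longleftrightarrow>
      (\<exists>ys. length ys = length Gs \<and> (\<forall>i < length Gs. ys ! i = (Gs ! i) xs) \<and> eval f ys z)"
      unfolding eval_Comp_iff using r that by auto
    also have "\<dots> \<longleftrightarrow> (\<exists>ys. ys = map (\<lambda>G. G xs) Gs \<and> eval f ys z)"
      by (auto simp: list_eq_iff_nth_eq)
    also have "\<dots> \<longleftrightarrow> z = F (map (\<lambda>G. G xs) Gs)"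
      using f by auto
    finally show ?thesis .
  qed
  then show ?thesis unfolding total_comp_def by blast
qed

lemma total_comp_nth: "i < n \<Longrightarrow> total_comp n (\<lambda>xs. xs ! i)"
  unfolding total_comp_def by (intro exI[of _ "Proj i"]) (auto simp: eval_Proj_iff)

lemma hd_funpow_tl: "i < length xs \<Longrightarrow> hd ((tl ^^ i) xs) = xs ! i"
proof (induction i arbitrary: xs)
  case 0 then show ?case by (cases xs) auto
next
  case (Suc i) then show ?case by (cases xs) (auto simp: funpow_swap1)
qed

lemma total_comp_var: "i < n \<Longrightarrow> total_comp n (\<lambda>xs. hd ((tl ^^ i) xs))"
  using total_comp_nth[of i n] total_comp_cong[of n "\<lambda>xs. hd ((tl ^^ i) xs)" "\<lambda>xs. xs ! i"]
  by (simp add: hd_funpow_tl)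

text \<open>Environments are lists; the variable bound by the innermost binder is the head, so the
  \<open>i\<close>-th variable is \<open>hd (tl (... xs))\<close> with \<open>i\<close> occurrences of \<open>tl\<close>.\<close>

lemmas numeral_unary =
  numeral_eq_Suc pred_numeral_simps BitM.simps One_nat_def funpow.simps o_apply id_apply

lemmas total_comp_vars =
  total_comp_var[of 0, simplified] total_comp_var[of 1, simplified]
  total_comp_var[of 2, simplified numeral_unary] total_comp_var[of 3, simplified numeral_unary]
  total_comp_var[of 4, simplified numeral_unary] total_comp_var[of 5, simplified numeral_unary]
  total_comp_var[of 6, simplified numeral_unary] total_comp_var[of 7, simplified numeral_unary]
  total_comp_var[of 8, simplified numeral_unary] total_comp_var[of 9, simplified numeral_unary]
  total_comp_var[of 10, simplified numeral_unary] total_comp_var[of 11, simplified numeral_unary]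
  total_comp_var[of 12, simplified numeral_unary] total_comp_var[of 13, simplified numeral_unary]
  total_comp_var[of 14, simplified numeral_unary] total_comp_var[of 15, simplified numeral_unary]
  total_comp_var[of 16, simplified numeral_unary] total_comp_var[of 17, simplified numeral_unary]
  total_comp_var[of 18, simplified numeral_unary] total_comp_var[of 19, simplified numeral_unary]
  total_comp_var[of 20, simplified numeral_unary]

lemma total_comp_comp1:
  assumes "total_comp 1 (\<lambda>xs. F (hd xs))" "total_comp n A"
  shows "total_comp n (\<lambda>xs. F (A xs))"
  using total_comp_comp_list[of "[A]" "\<lambda>xs. F (hd xs)" n] assms by simp

lemma total_comp_comp2:
  assumes "total_comp 2 (\<lambda>xs. F (hd xs) (hd (tl xs)))" "total_comp n A" "total_comp n B"
  shows "total_comp n (\<lambda>xs. F (A xs) (B xs))"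
  using total_comp_comp_list[of "[A,B]" "\<lambda>xs. F (hd xs) (hd (tl xs))" n] assms by (auto simp: numeral_2_eq_2)

lemma total_comp_const: "total_comp n (\<lambda>xs. c)"
proof (induction c)
  case 0
  show ?case unfolding total_comp_def by (intro exI[of _ Zf]) (auto simp: eval_Zf_iff)
next
  case (Suc c)
  have "total_comp 1 (\<lambda>xs. Suc (hd xs))"
    unfolding total_comp_def by (intro exI[of _ Sf]) (auto simp: eval_Sf_iff length_Suc_conv)
  from total_comp_comp1[OF this Suc] show ?case .
qed

lemma total_comp_Suc:
  assumes "total_comp n A" shows "total_comp n (\<lambda>xs. Suc (A xs))"
proof (rule total_comp_comp1[OF _ assms])
  show "total_comp 1 (\<lambda>xs. Suc (hd xs))"
    unfolding total_comp_def by (intro exI[of _ Sf]) (auto simp: eval_Sf_iff length_Suc_conv)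
qed

lemma total_comp_rec:
  assumes K: "total_comp n K" and G: "total_comp n G"
    and H: "total_comp (Suc (Suc n)) (\<lambda>ys. H (hd ys) (hd (tl ys)) (tl (tl ys)))"
  shows "total_comp n (\<lambda>xs. rec_nat (G xs) (\<lambda>m y. H m y xs) (K xs))"
proof -
  obtain g where g: "\<And>xs z. length xs = n \<Longrightarrow> eval g xs z \<longleftrightarrow> z = G xs"
    using G unfolding total_comp_def by blast
  obtain h where h: "\<And>xs z. length xs = Suc (Suc n) \<Longrightarrow>
      eval h xs z \<longleftrightarrow> z = H (hd xs) (hd (tl xs)) (tl (tl xs))"
    using H unfolding total_comp_def by blast
  have *: "eval (Prec g h) (m # xs) z \<longleftrightarrow> z = rec_nat (G xs) (\<lambda>m y. H m y xs) m"
    if "length xs = n" for m xs z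
    using that by (induction m arbitrary: z) (auto simp: eval_Prec_0_iff eval_Prec_Suc_iff g h)
  have "total_comp (Suc n) (\<lambda>ys. rec_nat (G (tl ys)) (\<lambda>m y. H m y (tl ys)) (hd ys))"
    unfolding total_comp_def by (rule exI[of _ "Prec g h"]) (auto simp: * length_Suc_conv)
  moreover have "total_comp n F" if "F \<in> set (K # map (\<lambda>i xs. xs ! i) [0..<n])" for F
    using that K by (auto intro: total_comp_nth)
  ultimately have "total_comp n (\<lambda>xs. (\<lambda>ys. rec_nat (G (tl ys)) (\<lambda>m y. H m y (tl ys)) (hd ys))
      (map (\<lambda>F. F xs) (K # map (\<lambda>i xs. xs ! i) [0..<n])))"
    by (intro total_comp_comp_list) auto
  moreover have "map (\<lambda>F. F xs) (map (\<lambda>i xs. xs ! i) [0..<n]) = xs" if "length xs = n" for xs :: "nat list"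
    using that by (auto simp: list_eq_iff_nth_eq)
  ultimately show ?thesis
    by (subst total_comp_cong[where G = "\<lambda>xs. (\<lambda>ys. rec_nat (G (tl ys)) (\<lambda>m y. H m y (tl ys)) (hd ys))
      (map (\<lambda>F. F xs) (K # map (\<lambda>i xs. xs ! i) [0..<n]))"]) auto
qed

section \<open>Closure under arithmetic, Boolean operations and case distinction\<close>

lemma total_comp_add: assumes "total_comp n A" "total_comp n B" shows "total_comp n (\<lambda>xs. A xs + B xs)"
proof (rule total_comp_comp2[OF _ assms])
  have "rec_nat a (\<lambda>m y. Suc y) b = a + b" for a b :: nat by (induction b) auto
  moreover have "total_comp 2 (\<lambda>xs. rec_nat (hd xs) (\<lambda>m y. Suc y) (hd (tl xs)))"
    by (intro total_comp_rec total_comp_Suc total_comp_vars) simp_all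
  ultimately show "total_comp 2 (\<lambda>xs. hd xs + hd (tl xs))" by simp
qed

lemma total_comp_mult: assumes "total_comp n A" "total_comp n B" shows "total_comp n (\<lambda>xs. A xs * B xs)"
proof (rule total_comp_comp2[OF _ assms])
  have "rec_nat 0 (\<lambda>m y. y + a) b = a * b" for a b :: nat by (induction b) auto
  moreover have "total_comp 2 (\<lambda>xs. rec_nat 0 (\<lambda>m y. y + hd xs) (hd (tl xs)))"
    by (intro total_comp_rec total_comp_add total_comp_const total_comp_vars) simp_all
  ultimately show "total_comp 2 (\<lambda>xs. hd xs * hd (tl xs))" by simp
qed

lemma total_comp_power: assumes "total_comp n A" "total_comp n B" shows "total_comp n (\<lambda>xs. A xs ^ B xs)"
proof (rule total_comp_comp2[OF _ assms])
  have "rec_nat 1 (\<lambda>m y. y * a) b = a ^ b" for a b :: nat by (induction b) auto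
  moreover have "total_comp 2 (\<lambda>xs. rec_nat 1 (\<lambda>m y. y * hd xs) (hd (tl xs)))"
    by (intro total_comp_rec total_comp_mult total_comp_const total_comp_vars) simp_all
  ultimately show "total_comp 2 (\<lambda>xs. hd xs ^ hd (tl xs))" by simp
qed

lemma total_comp_diff: assumes "total_comp n A" "total_comp n B" shows "total_comp n (\<lambda>xs. A xs - B xs)"
proof (rule total_comp_comp2[OF _ assms])
  have "rec_nat 0 (\<lambda>m y. m) b = b - 1" for b :: nat by (induction b) auto
  moreover have "total_comp 1 (\<lambda>xs. rec_nat 0 (\<lambda>m y. m) (hd xs))"
    by (intro total_comp_rec total_comp_const total_comp_vars) simp_all
  ultimately have pred: "total_comp 1 (\<lambda>xs. hd xs - 1)" by simp
  have "rec_nat a (\<lambda>m y. y - 1) b = a - b" for a b :: nat by (induction b) auto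
  moreover have "total_comp 2 (\<lambda>xs. rec_nat (hd xs) (\<lambda>m y. y - 1) (hd (tl xs)))"
    by (intro total_comp_rec total_comp_comp1[OF pred] total_comp_const total_comp_vars) simp_all
  ultimately show "total_comp 2 (\<lambda>xs. hd xs - hd (tl xs))" by simp
qed

lemma total_comp_not:
  assumes "total_comp n (\<lambda>xs. of_bool (P xs))" shows "total_comp n (\<lambda>xs. of_bool (\<not> P xs))"
proof -
  have "of_bool (\<not> p) = 1 - (of_bool p :: nat)" for p by auto
  then show ?thesis using assms by (simp only:) (intro total_comp_diff total_comp_const)
qed

lemma total_comp_conj:
  assumes "total_comp n (\<lambda>xs. of_bool (P xs))" "total_comp n (\<lambda>xs. of_bool (Q xs))"
  shows "total_comp n (\<lambda>xs. of_bool (P xs \<and> Q xs))"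
  using total_comp_mult[OF assms] by (simp only: of_bool_conj)

lemma total_comp_disj:
  assumes "total_comp n (\<lambda>xs. of_bool (P xs))" "total_comp n (\<lambda>xs. of_bool (Q xs))"
  shows "total_comp n (\<lambda>xs. of_bool (P xs \<or> Q xs))"
  using total_comp_not[OF total_comp_conj[OF total_comp_not[OF assms(1)] total_comp_not[OF assms(2)]]] by simp

lemma total_comp_le:
  assumes "total_comp n A" "total_comp n B" shows "total_comp n (\<lambda>xs. of_bool (A xs \<le> B xs))"
proof -
  have "of_bool (a \<le> b) = 1 - (a - b)" for a b :: nat by auto
  then show ?thesis using assms by (simp only:) (intro total_comp_diff total_comp_const)
qed

lemma total_comp_less:
  assumes "total_comp n A" "total_comp n B" shows "total_comp n (\<lambda>xs. of_bool (A xs < B xs))"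
  using total_comp_not[OF total_comp_le[OF assms(2,1)]] by (simp add: not_le)

lemma total_comp_eq:
  assumes "total_comp n A" "total_comp n B" shows "total_comp n (\<lambda>xs. of_bool (A xs = B xs))"
  using total_comp_conj[OF total_comp_le[OF assms] total_comp_le[OF assms(2,1)]] by (simp only: order_eq_iff)

lemma total_comp_if:
  assumes "total_comp n (\<lambda>xs. of_bool (P xs))" "total_comp n A" "total_comp n B"
  shows "total_comp n (\<lambda>xs. if P xs then A xs else B xs)"
proof -
  have "(if p then a else b) = of_bool p * a + of_bool (\<not> p) * b" for p and a b :: nat by auto
  then show ?thesis using assms by (simp only:) (intro total_comp_add total_comp_mult total_comp_not)
qed

text \<open>Weakening: in a recursion the accumulator sits between the counter and the environment,
  and the summand must be able to ignore it.\<close>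

lemma total_comp_drop_second:
  assumes "total_comp (Suc n) (\<lambda>ys. F (hd ys) (tl ys))"
  shows "total_comp (Suc (Suc n)) (\<lambda>ys. F (hd ys) (tl (tl ys)))"
proof -
  let ?Gs = "(\<lambda>xs. xs ! 0) # map (\<lambda>i xs. xs ! Suc (Suc i)) [0..<n]"
  have "total_comp (Suc (Suc n)) (\<lambda>xs. (\<lambda>ys. F (hd ys) (tl ys)) (map (\<lambda>G. G xs) ?Gs))"
    by (rule total_comp_comp_list) (use assms in \<open>auto intro: total_comp_nth\<close>)
  then show ?thesis
  proof (rule total_comp_cong[THEN iffD1, rotated])
    fix xs :: "nat list" assume "length xs = Suc (Suc n)"
    then obtain x y ys where "xs = x # y # ys" "n = length ys"
      by (auto simp: length_Suc_conv)
    then have "map (\<lambda>G. G xs) ?Gs = hd xs # tl (tl xs)"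
      by (auto simp: comp_def map_nth)
    then show "F (hd (map (\<lambda>G. G xs) ?Gs)) (tl (map (\<lambda>G. G xs) ?Gs)) = F (hd xs) (tl (tl xs))"
      by (simp only: list.sel)
  qed
qed

section \<open>Bounded sums, quantifiers and search\<close>

lemma total_comp_sum:
  assumes "total_comp n B" "total_comp (Suc n) (\<lambda>ys. F (hd ys) (tl ys))"
  shows "total_comp n (\<lambda>xs. \<Sum>i<B xs. F i xs)"
proof -
  have "total_comp (Suc (Suc n)) (\<lambda>ys. hd (tl ys) + F (hd ys) (tl (tl ys)))"
    by (intro total_comp_add total_comp_drop_second assms total_comp_vars) simp_all
  from total_comp_rec[OF assms(1) total_comp_const[of n 0] this]
  have "total_comp n (\<lambda>xs. rec_nat 0 (\<lambda>m y. y + F m xs) (B xs))" by simp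
  moreover have "rec_nat 0 (\<lambda>m y. y + F m xs) b = (\<Sum>i<b. F i xs)" for b xs
    by (induction b) auto
  ultimately show ?thesis by simp
qed

lemma total_comp_ex:
  assumes "total_comp n B" "total_comp (Suc n) (\<lambda>ys. of_bool (P (hd ys) (tl ys)))"
  shows "total_comp n (\<lambda>xs. of_bool (\<exists>i<B xs. P i xs))"
proof -
  have "of_bool (\<exists>i<b. P i xs) = (of_bool ((\<Sum>i<b. of_bool (P i xs) :: nat) \<noteq> 0) :: nat)" for b xs
    by auto
  then show ?thesis using assms
    by (simp only:) (intro total_comp_not total_comp_eq total_comp_const total_comp_sum)
qed

lemma total_comp_all:
  assumes "total_comp n B" "total_comp (Suc n) (\<lambda>ys. of_bool (P (hd ys) (tl ys)))"
  shows "total_comp n (\<lambda>xs. of_bool (\<forall>i<B xs. P i xs))"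
  using total_comp_not[OF total_comp_ex[OF assms(1) total_comp_not[OF assms(2)]]] by simp

text \<open>Each \<open>i\<close> before the first witness contributes one, so the value is the
  least witness, or \<open>b\<close> if there is none below \<open>b\<close>. As a sum it inherits
  computability from \<open>total_comp_sum\<close>.\<close>

definition bleast :: "(nat \<Rightarrow> bool) \<Rightarrow> nat \<Rightarrow> nat" where
  "bleast P b = (\<Sum>i<b. of_bool (\<forall>j<Suc i. \<not> P j))"

lemma bleast_eq:
  assumes "P i" "i < b" "\<And>j. j < i \<Longrightarrow> \<not> P j"
  shows "bleast P b = i"
proof -
  have "bleast P b = card ({..<b} \<inter> {m. \<forall>j<Suc m. \<not> P j})"
    unfolding bleast_def by (simp add: sum_of_bool_eq)
  also have "{..<b} \<inter> {m. \<forall>j<Suc m. \<not> P j} = {..<i}"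
  proof (intro set_eqI iffI)
    fix m assume m: "m \<in> {..<b} \<inter> {m. \<forall>j<Suc m. \<not> P j}"
    show "m \<in> {..<i}"
    proof (rule ccontr)
      assume "m \<notin> {..<i}"
      then have "i < Suc m" by simp
      with m assms(1) show False by blast
    qed
  qed (use assms in auto)
  finally show ?thesis by simp
qed

lemma bleast:
  assumes "P i" "i < b"
  shows "P (bleast P b)" "bleast P b \<le> i"
proof -
  have P: "P (LEAST i. P i)" and le: "(LEAST i. P i) \<le> i"
    using assms(1) by (rule LeastI, rule Least_le)
  have "bleast P b = (LEAST i. P i)"
    by (rule bleast_eq[where P = P, OF P]) (use le assms(2) in \<open>auto dest: not_less_Least\<close>)
  then show "P (bleast P b)" "bleast P b \<le> i"
    using P le by simp_all
qed

lemma total_comp_bleast: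
  assumes "total_comp n B" "total_comp (Suc n) (\<lambda>ys. of_bool (P (hd ys) (tl ys)))"
  shows "total_comp n (\<lambda>xs. bleast (\<lambda>i. P i xs) (B xs))"
  unfolding bleast_def
proof (rule total_comp_sum[OF assms(1)])
  show "total_comp (Suc n) (\<lambda>ys. of_bool (\<forall>j<Suc (hd ys). \<not> P j (tl ys)))"
    by (intro total_comp_all total_comp_Suc total_comp_not total_comp_vars total_comp_drop_second[where F = "\<lambda>i xs. of_bool (P i xs)"] assms) simp_all
qed

lemma total_comp_div: assumes "total_comp n A" "total_comp n B" shows "total_comp n (\<lambda>xs. A xs div B xs)"
proof (rule total_comp_comp2[OF _ assms])
  have "a div b = (if b = 0 then 0 else bleast (\<lambda>q. a < Suc q * b) (Suc a))" for a b :: nat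
  proof (cases "b = 0")
    case False
    have "bleast (\<lambda>q. a < Suc q * b) (Suc a) = a div b"
    proof (rule bleast_eq)
      show "a < Suc (a div b) * b"
        using False by (metis dividend_less_div_times mult_Suc bot_nat_0.not_eq_extremum)
      show "\<not> a < Suc j * b" if "j < a div b" for j
        using that False by (metis Suc_leI less_eq_div_iff_mult_less_eq not_le bot_nat_0.not_eq_extremum)
    qed (simp add: le_imp_less_Suc)
    with False show ?thesis by simp
  qed simp
  then have eq: "(\<lambda>xs. hd xs div hd (tl xs)) = (\<lambda>xs. if hd (tl xs) = 0 then 0
      else bleast (\<lambda>q. hd xs < Suc q * hd (tl xs)) (Suc (hd xs)))" by blast
  show "total_comp 2 (\<lambda>xs. hd xs div hd (tl xs))"
    unfolding eq by (intro total_comp_if total_comp_eq total_comp_bleast total_comp_less total_comp_mult total_comp_Suc total_comp_const total_comp_vars) simp_all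
qed

lemma total_comp_mod: assumes "total_comp n A" "total_comp n B" shows "total_comp n (\<lambda>xs. A xs mod B xs)"
  unfolding minus_div_mult_eq_mod[symmetric] using assms by (intro total_comp_diff total_comp_mult total_comp_div)

lemmas total_comp_intros = total_comp_const total_comp_Suc total_comp_add total_comp_mult total_comp_power total_comp_diff total_comp_not total_comp_conj total_comp_disj
  total_comp_le total_comp_less total_comp_eq total_comp_if total_comp_sum total_comp_ex total_comp_all total_comp_bleast total_comp_div total_comp_mod

section \<open>Step-bounded evaluation\<close>

text \<open>The value \<open>0\<close> means that no result was found within the bound \<open>t\<close> on the unbounded
  searches, and \<open>Suc z\<close> that the result is \<open>z\<close>.\<close>

fun eval_within :: "recf \<Rightarrow> nat \<Rightarrow> nat list \<Rightarrow> nat" where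
  "eval_within Zf t xs = 1"
| "eval_within Sf t xs = (if xs = [] then 0 else Suc (Suc (hd xs)))"
| "eval_within (Proj i) t xs = (if i < length xs then Suc (xs ! i) else 0)"
| "eval_within (Comp f gs) t xs =
    (if \<forall>g\<in>set gs. eval_within g t xs \<noteq> 0 then eval_within f t (map (\<lambda>g. eval_within g t xs - 1) gs) else 0)"
| "eval_within (Prec g h) t xs = (if xs = [] then 0 else
     rec_nat (eval_within g t (tl xs)) (\<lambda>m y. if y = 0 then 0 else eval_within h t (m # (y - 1) # tl xs)) (hd xs))"
| "eval_within (Mn f) t xs =
    (if bleast (\<lambda>m. eval_within f t (m # xs) \<le> 1) t < t \<and> eval_within f t (bleast (\<lambda>m. eval_within f t (m # xs) \<le> 1) t # xs) = 1
     then Suc (bleast (\<lambda>m. eval_within f t (m # xs) \<le> 1) t) else 0)"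

lemma eval_within_Prec_simps:
  "eval_within (Prec g h) t (0 # xs) = eval_within g t xs"
  "eval_within (Prec g h) t (Suc n # xs) = (if eval_within (Prec g h) t (n # xs) = 0 then 0
     else eval_within h t (n # (eval_within (Prec g h) t (n # xs) - 1) # xs))"
  by (simp_all cong: if_cong)

text \<open>The search stops at the first \<open>m\<close> with coded value at most 1. A 1 codes the
  value zero and is a success; a 0 means that \<open>f\<close> itself found nothing, and then the
  search must fail rather than skip \<open>m\<close>.\<close>

lemma eval_within_MnI:
  assumes "eval_within f t (m # xs) = 1" "m < t" "\<And>j. j < m \<Longrightarrow> eval_within f t (j # xs) > 1"
  shows "eval_within (Mn f) t xs = Suc m"
proof -
  have "bleast (\<lambda>m. eval_within f t (m # xs) \<le> 1) t = m"
    by (rule bleast_eq) (use assms not_le in auto)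
  with assms show ?thesis by simp
qed

lemma eval_within_MnD:
  assumes "eval_within (Mn f) t xs \<noteq> 0"
  obtains m where "eval_within (Mn f) t xs = Suc m" "eval_within f t (m # xs) = 1" "m < t" "\<forall>j<m. eval_within f t (j # xs) > 1"
proof -
  let ?m = "bleast (\<lambda>m. eval_within f t (m # xs) \<le> 1) t"
  have m: "?m < t" "eval_within f t (?m # xs) = 1" "eval_within (Mn f) t xs = Suc ?m"
    using assms by (auto split: if_splits)
  have "eval_within f t (j # xs) > 1" if "j < ?m" for j
    using bleast(2)[of "\<lambda>m. eval_within f t (m # xs) \<le> 1" j t] that m(1) by (meson not_le order.strict_trans)
  with m that show thesis by blast
qed

text \<open>A result once found never changes, so finitely many bounds can be merged into a larger
  one. Completeness rests on this, and so does the monotonicity of the enumeration in the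
  game.\<close>

lemma eval_within_mono: "eval_within r t xs \<noteq> 0 \<Longrightarrow> t \<le> t' \<Longrightarrow> eval_within r t' xs = eval_within r t xs"
proof (induction r arbitrary: xs)
  case (Comp f gs)
  have *: "\<forall>g\<in>set gs. eval_within g t xs \<noteq> 0" and **: "eval_within f t (map (\<lambda>g. eval_within g t xs - 1) gs) \<noteq> 0"
    using Comp.prems by (auto split: if_splits)
  have "\<forall>g\<in>set gs. eval_within g t' xs = eval_within g t xs" using Comp.IH(2) * Comp.prems by blast
  moreover from this have "map (\<lambda>g. eval_within g t' xs - 1) gs = map (\<lambda>g. eval_within g t xs - 1) gs" by simp
  ultimately show ?case using Comp.IH(1)[OF ** Comp.prems(2)] * by (simp only: eval_within.simps) simp
next
  case (Prec g h)
  show ?case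
  proof (cases xs)
    case (Cons n ys)
    have "eval_within (Prec g h) t (n # ys) \<noteq> 0 \<Longrightarrow> eval_within (Prec g h) t' (n # ys) = eval_within (Prec g h) t (n # ys)"
      by (induction n) (use Prec.IH Prec.prems(2) in \<open>auto simp: eval_within_Prec_simps simp del: eval_within.simps(5) split: if_splits\<close>)
    with Prec.prems Cons show ?thesis by blast
  qed (use Prec in simp)
next
  case (Mn f)
  obtain m where m: "eval_within (Mn f) t xs = Suc m" "eval_within f t (m # xs) = 1" "m < t"
      "\<forall>j<m. eval_within f t (j # xs) > 1"
    using Mn.prems(1) by (rule eval_within_MnD)
  have "eval_within (Mn f) t' xs = Suc m"
    by (rule eval_within_MnI) (use m Mn.IH Mn.prems(2) in \<open>fastforce+\<close>)
  with m show ?case by simp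
qed auto

lemma eval_within_sound: "eval_within r t xs = Suc z \<Longrightarrow> eval r xs z"
proof (induction r arbitrary: xs z)
  case (Comp f gs)
  then show ?case
    by (auto simp: eval_Comp_iff split: if_splits intro!: exI[of _ "map (\<lambda>g. eval_within g t xs - 1) gs"])
next
  case (Prec g h)
  show ?case
  proof (cases xs)
    case (Cons n ys)
    have "eval_within (Prec g h) t (n # ys) = Suc z \<Longrightarrow> eval (Prec g h) (n # ys) z" for n z
    proof (induction n arbitrary: z)
      case (Suc n)
      then obtain y where "eval_within (Prec g h) t (n # ys) = Suc y"
        by (auto simp: eval_within_Prec_simps gr0_conv_Suc simp del: eval_within.simps(5) split: if_splits)
      with Suc show ?case
        by (auto simp: eval_within_Prec_simps eval_Prec_Suc_iff simp del: eval_within.simps(5) intro!: Prec.IH exI[of _ y])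
    qed (use Prec.IH in \<open>auto simp: eval_Prec_0_iff eval_within_Prec_simps simp del: eval_within.simps(5)\<close>)
    with Prec.prems Cons show ?thesis by blast
  qed (use Prec in simp)
next
  case (Mn f)
  then have "eval_within (Mn f) t xs \<noteq> 0" by simp
  then obtain m where m: "eval_within (Mn f) t xs = Suc m" "eval_within f t (m # xs) = 1" "m < t"
      "\<forall>j<m. eval_within f t (j # xs) > 1"
    by (rule eval_within_MnD)
  have "\<exists>y>0. eval f (j # xs) y" if "j < m" for j
    using m(4)[rule_format, OF that] Mn.IH[of "j # xs" "eval_within f t (j # xs) - 1"]
    by (intro exI[of _ "eval_within f t (j # xs) - 1"]) auto
  with m Mn show ?case by (auto simp: eval_Mn_iff)
qed (auto simp: eval_Zf_iff eval_Sf_iff eval_Proj_iff neq_Nil_conv split: if_splits)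

lemma eval_within_complete: "eval r xs z \<Longrightarrow> \<exists>t. eval_within r t xs = Suc z"
proof (induction rule: eval.induct)
  case (eval_Comp ys gs xs f z)
  then have "\<forall>i<length gs. \<exists>t. eval_within (gs ! i) t xs = Suc (ys ! i)" by blast
  then obtain T where T: "\<And>i. i < length gs \<Longrightarrow> eval_within (gs ! i) (T i) xs = Suc (ys ! i)" by metis
  obtain u where u: "eval_within f u ys = Suc z" using eval_Comp by blast
  define t where "t = u + (\<Sum>i<length gs. T i)"
  have Tt: "T i \<le> t" if "i < length gs" for i
    using that member_le_sum[of i "{..<length gs}" T] unfolding t_def by auto
  have *: "eval_within (gs ! i) t xs = Suc (ys ! i)" if "i < length gs" for i
    using eval_within_mono[of "gs ! i" "T i" xs t] T[OF that] Tt[OF that] by simp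
  then have "map (\<lambda>g. eval_within g t xs - 1) gs = ys"
    using eval_Comp(1) by (auto simp: list_eq_iff_nth_eq)
  moreover have "\<forall>g\<in>set gs. eval_within g t xs \<noteq> 0" using * by (auto simp: in_set_conv_nth)
  moreover have "eval_within f t ys = Suc z" using eval_within_mono[of f u ys t] u unfolding t_def by simp
  ultimately have "eval_within (Comp f gs) t xs = Suc z" by simp
  then show ?case by blast
next
  case (eval_PrecS g h n xs y z)
  then obtain t u where t: "eval_within (Prec g h) t (n # xs) = Suc y" "eval_within h u (n # y # xs) = Suc z" by blast
  have "eval_within (Prec g h) (max t u) (n # xs) = Suc y"
    using eval_within_mono[of "Prec g h" t "n # xs" "max t u"] t by simp
  moreover have "eval_within h (max t u) (n # y # xs) = Suc z"
    using eval_within_mono[of h u "n # y # xs" "max t u"] t by simp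
  ultimately have "eval_within (Prec g h) (max t u) (Suc n # xs) = Suc z"
    by (simp add: eval_within_Prec_simps del: eval_within.simps(5))
  then show ?case by blast
next
  case (eval_Mn f n xs)
  then obtain u where u: "eval_within f u (n # xs) = Suc 0" by auto
  from eval_Mn have "\<forall>m<n. \<exists>y t. y > 0 \<and> eval_within f t (m # xs) = Suc y" by blast
  then obtain Y T where T: "\<And>m. m < n \<Longrightarrow> Y m > 0 \<and> eval_within f (T m) (m # xs) = Suc (Y m)" by metis
  define t where "t = u + Suc n + (\<Sum>i<n. T i)"
  have Tt: "T i \<le> t" if "i < n" for i
    using that member_le_sum[of i "{..<n}" T] unfolding t_def by auto
  have "eval_within (Mn f) t xs = Suc n"
  proof (rule eval_within_MnI)
    show "eval_within f t (n # xs) = 1" using u eval_within_mono[of f u "n # xs" t] by (simp add: t_def)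
    show "n < t" by (simp add: t_def)
    show "eval_within f t (j # xs) > 1" if "j < n" for j
      using T[OF that] Tt[OF that] eval_within_mono[of f "T j" "j # xs" t] by simp
  qed
  then show ?case by blast
qed auto

lemma eval_iff_eval_within: "eval r xs z \<longleftrightarrow> (\<exists>t. eval_within r t xs = Suc z)"
  using eval_within_sound eval_within_complete by blast

lemma total_comp_list_all:
  assumes "\<And>G. G \<in> set Gs \<Longrightarrow> total_comp n G"
  shows "total_comp n (\<lambda>xs. of_bool (\<forall>G\<in>set Gs. G xs \<noteq> 0))"
  using assms
proof (induction Gs)
  case Nil then show ?case by (simp add: total_comp_const)
next
  case (Cons G Gs)
  then have "total_comp n (\<lambda>xs. of_bool (G xs \<noteq> 0 \<and> (\<forall>G\<in>set Gs. G xs \<noteq> 0)))"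
    by (intro total_comp_conj total_comp_not total_comp_eq total_comp_const) auto
  then show ?case by simp
qed

text \<open>Rewiring of environments: a subprogram is called with computed values in front of what
  remains after dropping \<open>j\<close> variables.\<close>

lemma total_comp_Cons_comp:
  assumes F: "total_comp (m + n) F" and "length Gs = m" "\<And>G. G \<in> set Gs \<Longrightarrow> total_comp k G"
    and "k = j + n"
  shows "total_comp k (\<lambda>xs. F (map (\<lambda>G. G xs) Gs @ (tl ^^ j) xs))"
proof -
  let ?Gs = "Gs @ map (\<lambda>i xs. xs ! (j + i)) [0..<n]"
  have "total_comp k (\<lambda>xs. F (map (\<lambda>G. G xs) ?Gs))"
    by (rule total_comp_comp_list) (use assms in \<open>auto intro: total_comp_nth\<close>)
  moreover have "map (\<lambda>G. G xs) ?Gs = map (\<lambda>G. G xs) Gs @ (tl ^^ j) xs" if "length xs = k" for xs :: "nat list"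
  proof -
    have "(tl ^^ j) xs = drop j xs" for j and xs :: "nat list"
      by (induction j arbitrary: xs) (auto simp: drop_Suc tl_drop)
    moreover have "map (\<lambda>i. xs ! (j + i)) [0..<n] = drop j xs"
      using that assms by (auto simp: list_eq_iff_nth_eq)
    ultimately show ?thesis by (simp add: comp_def)
  qed
  ultimately show ?thesis
    by (subst total_comp_cong[where G = "\<lambda>xs. F (map (\<lambda>G. G xs) ?Gs)"]) auto
qed

text \<open>Since \<open>r\<close> is fixed, induction over \<open>r\<close> suffices;
  \<open>n\<close> varies because subprograms have other arities.\<close>

lemma total_comp_eval_within: "total_comp (Suc n) (\<lambda>ys. eval_within r (hd ys) (tl ys))"
proof (induction r arbitrary: n)
  case Zf show ?case by (simp add: total_comp_const)
next
  case Sf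
  show ?case
  proof (cases n)
    case 0
    have "total_comp (Suc n) (\<lambda>ys. 0)" by (rule total_comp_const)
    then show ?thesis by (rule total_comp_cong[THEN iffD1, rotated]) (auto simp: 0 length_Suc_conv)
  next
    case (Suc m)
    have "total_comp (Suc n) (\<lambda>ys. Suc (Suc (hd (tl ys))))" by (intro total_comp_Suc total_comp_vars) (simp add: Suc)
    then show ?thesis by (rule total_comp_cong[THEN iffD1, rotated]) (auto simp: Suc length_Suc_conv)
  qed
next
  case (Proj i)
  show ?case
  proof (cases "i < n")
    case False
    have "total_comp (Suc n) (\<lambda>ys. 0)" by (rule total_comp_const)
    then show ?thesis by (rule total_comp_cong[THEN iffD1, rotated]) (use False in auto)
  next
    case True
    have "total_comp (Suc n) (\<lambda>ys. Suc (ys ! Suc i))" by (intro total_comp_Suc total_comp_nth) (simp add: True)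
    then show ?thesis by (rule total_comp_cong[THEN iffD1, rotated]) (use True in \<open>auto simp: nth_tl\<close>)
  qed
next
  case (Comp f gs)
  let ?Gs = "map (\<lambda>g ys. eval_within g (hd ys) (tl ys)) gs"
  let ?Hs = "hd # map (\<lambda>g ys. eval_within g (hd ys) (tl ys) - 1) gs"
  have "total_comp (Suc n) (\<lambda>xs. of_bool (\<forall>G\<in>set ?Gs. G xs \<noteq> 0))"
    by (rule total_comp_list_all) (use Comp.IH(2) in auto)
  moreover have "total_comp (Suc n) (\<lambda>xs. (\<lambda>ys. eval_within f (hd ys) (tl ys)) (map (\<lambda>G. G xs) ?Hs))"
  proof (rule total_comp_comp_list)
    fix G assume "G \<in> set ?Hs"
    then consider "G = hd" | g where "g \<in> set gs" "G = (\<lambda>ys. eval_within g (hd ys) (tl ys) - 1)" by auto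
    then show "total_comp (Suc n) G"
      by cases (use Comp.IH(2) in \<open>auto intro: total_comp_diff total_comp_const total_comp_vars\<close>)
  qed (use Comp.IH(1)[of "length gs"] in simp)
  ultimately have "total_comp (Suc n) (\<lambda>xs. if \<forall>G\<in>set ?Gs. G xs \<noteq> 0
      then (\<lambda>ys. eval_within f (hd ys) (tl ys)) (map (\<lambda>G. G xs) ?Hs) else 0)"
    by (intro total_comp_if total_comp_const)
  then show ?case by (simp add: comp_def cong: if_cong)
next
  case (Prec g h)
  show ?case
  proof (cases n)
    case 0
    have "total_comp (Suc n) (\<lambda>ys. 0)" by (rule total_comp_const)
    then show ?thesis by (rule total_comp_cong[THEN iffD1, rotated]) (auto simp: 0 length_Suc_conv)
  next
    case (Suc m)
    have g: "total_comp (Suc n) (\<lambda>ys. eval_within g (hd ys) (tl (tl ys)))"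
      using total_comp_Cons_comp[of 1 m "\<lambda>ys. eval_within g (hd ys) (tl ys)" "[hd]" "Suc n" 2]
        Prec.IH(1)[of m] total_comp_vars(1)[of "Suc n"] Suc by (auto simp: numeral_2_eq_2)
    \<comment> \<open>\<open>us\<close> holds counter, accumulator, bound, recursion argument and
      the other arguments. \<open>h\<close> is called with the bound first, then counter, decoded
      accumulator and the other arguments.\<close>
    let ?Gs = "[\<lambda>us. hd (tl (tl us)), hd, \<lambda>us. hd (tl us) - 1]"
    have "total_comp (Suc (Suc (Suc n))) G" if "G \<in> set ?Gs" for G
      using that Suc by (auto intro: total_comp_vars total_comp_diff total_comp_const)
    then have "total_comp (Suc (Suc (Suc n))) (\<lambda>us. (\<lambda>ys. eval_within h (hd ys) (tl ys)) (map (\<lambda>G. G us) ?Gs @ (tl ^^ 4) us))"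
      by (intro total_comp_Cons_comp[of 3 m]) (use Prec.IH(2)[of "Suc (Suc m)"] Suc in \<open>auto simp: eval_nat_numeral\<close>)
    then have h: "total_comp (Suc (Suc (Suc n))) (\<lambda>us. eval_within h (hd (tl (tl us)))
        (hd us # (hd (tl us) - 1) # tl (tl (tl (tl us)))))"
      by (simp add: eval_nat_numeral)
    have "total_comp (Suc n) (\<lambda>ys. rec_nat (eval_within g (hd ys) (tl (tl ys)))
       (\<lambda>m y. if y = 0 then 0 else eval_within h (hd ys) (m # (y - 1) # tl (tl ys))) (hd (tl ys)))"
      by (intro total_comp_rec total_comp_if total_comp_eq total_comp_const g h total_comp_vars) (use Suc in auto)
    then show ?thesis by (rule total_comp_cong[THEN iffD1, rotated]) (auto simp: Suc length_Suc_conv)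
  qed
next
  case (Mn f)
  have "total_comp (Suc (Suc n)) (\<lambda>us. (\<lambda>ys. eval_within f (hd ys) (tl ys)) (map (\<lambda>G. G us) [\<lambda>us. hd (tl us), hd] @ (tl ^^ 2) us))"
    by (intro total_comp_Cons_comp[of 2 n])
      (use Mn.IH[of "Suc n"] in \<open>auto simp: eval_nat_numeral intro: total_comp_vars\<close>)
  then have 1: "total_comp (Suc (Suc n)) (\<lambda>us. eval_within f (hd (tl us)) (hd us # tl (tl us)))"
    by (simp add: eval_nat_numeral)
  let ?b = "\<lambda>ys. bleast (\<lambda>m. eval_within f (hd ys) (m # tl ys) \<le> 1) (hd ys)"
  have b: "total_comp (Suc n) ?b"
    by (intro total_comp_bleast total_comp_le total_comp_const 1 total_comp_vars) auto
  have "total_comp (Suc n) (\<lambda>us. (\<lambda>ys. eval_within f (hd ys) (tl ys)) (map (\<lambda>G. G us) [hd, ?b] @ (tl ^^ 1) us))"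
    by (intro total_comp_Cons_comp[of 2 n])
      (use Mn.IH[of "Suc n"] b in \<open>auto simp: eval_nat_numeral intro: total_comp_vars\<close>)
  then have 2: "total_comp (Suc n) (\<lambda>ys. eval_within f (hd ys) (?b ys # tl ys))"
    by simp
  show ?case
    unfolding eval_within.simps by (intro total_comp_if total_comp_conj total_comp_less total_comp_eq total_comp_Suc total_comp_const 2 b total_comp_vars) auto
qed

section \<open>Strings as numbers\<close>

lemma s2n_n2s [simp]: "s2n (n2s m) = m"
  by (induction m rule: n2s.induct) (auto elim!: oddE)

lemma n2s_s2n [simp]: "n2s (s2n p) = p"
proof (induction p)
  case (Cons b p)
  have "s2n (b # p) = Suc (2 * s2n p + (if b then 1 else 0))" by simp
  then show ?case using Cons by (simp only: n2s.simps) auto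
qed simp

lemma n2s_inject: "n2s a = n2s b \<longleftrightarrow> a = b"
  by (metis s2n_n2s)

text \<open>In binary, \<open>m + 1\<close> is a leading 1 followed by the bits of the string, the
  head of the list being the least significant. So \<open>m + 1\<close> is a node of the tree with
  root 1, at depth \<open>length (n2s m)\<close>; hence the later shifts by one.\<close>

lemma length_n2s: "2 ^ length (n2s m) \<le> m + 1 \<and> m + 1 < 2 ^ Suc (length (n2s m))"
proof (induction m rule: n2s.induct)
  case (2 m)
  then show ?case by (cases "odd m") (auto elim!: oddE evenE)
qed simp

lemma length_n2s_le: "length (n2s m) \<le> l \<longleftrightarrow> m + 1 < 2 ^ Suc l"
proof
  assume "length (n2s m) \<le> l"
  then have "(2::nat) ^ Suc (length (n2s m)) \<le> 2 ^ Suc l" by (intro power_increasing) auto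
  with length_n2s[of m] show "m + 1 < 2 ^ Suc l" by linarith
next
  assume "m + 1 < 2 ^ Suc l"
  with length_n2s[of m] have "(2::nat) ^ length (n2s m) < 2 ^ Suc l" by linarith
  then show "length (n2s m) \<le> l" by (simp add: power_strict_increasing_iff del: power_Suc)
qed

lemma length_n2s_eq: "2 ^ l \<le> m + 1 \<Longrightarrow> m + 1 < 2 ^ Suc l \<Longrightarrow> length (n2s m) = l"
proof -
  assume *: "2 ^ l \<le> m + 1" "m + 1 < 2 ^ Suc l"
  then have "(2::nat) ^ l < 2 ^ Suc (length (n2s m))" using length_n2s[of m] by linarith
  then have "l \<le> length (n2s m)" by (simp add: power_strict_increasing_iff del: power_Suc)
  with * length_n2s_le[of m l] show ?thesis by simp
qed

section \<open>Decompressors given by unbounded search, and the fixed universal one\<close>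

lemma length_3: "length [a, b, c] = 3" by simp

lemma eval_Comp3:
  "eval (Comp h [a, b, c]) xs z \<longleftrightarrow> (\<exists>u v w. eval a xs u \<and> eval b xs v \<and> eval c xs w \<and> eval h [u, v, w] z)"
proof
  assume "eval (Comp h [a, b, c]) xs z"
  then obtain ys where ys: "length ys = length [a, b, c]"
      "\<And>i. i < length [a, b, c] \<Longrightarrow> eval ([a, b, c] ! i) xs (ys ! i)" "eval h ys z"
    unfolding eval_Comp_iff by blast
  then obtain u v w where uvw: "ys = [u, v, w]"
    by (auto simp: length_Suc_conv)
  from ys(2)[of 0] ys(2)[of 1] ys(2)[of 2] ys(3) uvw
  have "eval a xs u" "eval b xs v" "eval c xs w" "eval h [u, v, w] z" by simp_all
  then show "\<exists>u v w. eval a xs u \<and> eval b xs v \<and> eval c xs w \<and> eval h [u, v, w] z" by blast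
next
  assume "\<exists>u v w. eval a xs u \<and> eval b xs v \<and> eval c xs w \<and> eval h [u, v, w] z"
  then obtain u v w where *: "eval a xs u" "eval b xs v" "eval c xs w" "eval h [u, v, w] z" by blast
  show "eval (Comp h [a, b, c]) xs z"
    unfolding eval_Comp_iff by (rule exI[of _ "[u, v, w]"]) (use * in \<open>simp add: All_less_Suc\<close>)
qed

text \<open>Kleene normal form: one unbounded search over a total predicate, then a total function.
  Every decompressor built below has this shape, so only total functions have to be shown
  computable.\<close>

lemma computable2_search:
  assumes R: "total_comp 3 (\<lambda>xs. R (hd xs) (hd (tl xs)) (hd (tl (tl xs))))"
    and H: "total_comp 3 (\<lambda>xs. H (hd xs) (hd (tl xs)) (hd (tl (tl xs))))"
  shows "computable2 (\<lambda>p y. if \<exists>t. R t (s2n p) (s2n y) = 0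
    then Some (n2s (H (LEAST t. R t (s2n p) (s2n y) = 0) (s2n p) (s2n y))) else None)"
proof -
  obtain r where r: "\<And>t p y z. eval r [t, p, y] z \<longleftrightarrow> z = R t p y"
    using R unfolding total_comp_def by (metis length_3 list.sel(1,3))
  obtain h where h: "\<And>t p y z. eval h [t, p, y] z \<longleftrightarrow> z = H t p y"
    using H unfolding total_comp_def by (metis length_3 list.sel(1,3))
  have mn: "eval (Mn r) [p, y] t \<longleftrightarrow> R t p y = 0 \<and> (\<forall>m<t. R m p y \<noteq> 0)" for p y t
    by (auto simp: eval_Mn_iff r)
  have mn': "eval (Mn r) [p, y] t \<longleftrightarrow> (\<exists>t. R t p y = 0) \<and> t = (LEAST t. R t p y = 0)" for p y t
    unfolding mn using LeastI_ex[of "\<lambda>t. R t p y = 0"] not_less_Least[of _ "\<lambda>t. R t p y = 0"]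
    by (metis nat_neq_iff)
  have "eval (Comp h [Mn r, Proj 0, Proj 1]) [p, y] z \<longleftrightarrow>
      (\<exists>t. R t p y = 0) \<and> z = H (LEAST t. R t p y = 0) p y" for p y z
    unfolding eval_Comp3 mn' h by (auto simp: eval_Proj_iff)
  then show ?thesis
    unfolding computable2_def
    by (intro exI[of _ "Comp h [Mn r, Proj 0, Proj 1]"]) (auto simp: n2s_inject)
qed

text \<open>\<open>Dn t p\<close> is what stage \<open>t\<close> knows about the output of the
  program numbered \<open>p\<close> on the empty condition, coded as in \<open>eval_within\<close>.
  \<open>Dn_0\<close> lets the game start from an empty enumeration.\<close>

locale kolmogorov =
  fixes D :: "bool list \<Rightarrow> bool list \<Rightarrow> bool list option" and Dn :: "nat \<Rightarrow> nat \<Rightarrow> nat"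
  assumes universal: "universal D"
    and Dn_0: "Dn 0 p = 0"
    and Dn_mono: "Dn t p \<noteq> 0 \<Longrightarrow> t \<le> t' \<Longrightarrow> Dn t' p = Dn t p"
    and D_iff: "D (n2s p) [] = Some (n2s z) \<longleftrightarrow> (\<exists>t. Dn t p = Suc z)"
    and total_comp_Dn: "total_comp 2 (\<lambda>xs. Dn (hd xs) (hd (tl xs)))"

lemma ex_kolmogorov:
  assumes "universal D"
  shows "\<exists>Dn. kolmogorov D Dn"
proof -
  obtain f where "\<forall>p y z. eval f [s2n p, s2n y] z \<longleftrightarrow> D p y = Some (n2s z)"
    by (rule exE[OF assms[unfolded universal_def, THEN conjunct1, unfolded computable2_def]])
  then have f: "\<And>p y z. eval f [s2n p, s2n y] z \<longleftrightarrow> D p y = Some (n2s z)"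
    by (elim allE)
  \<comment> \<open>A program without unbounded search has its result already at bound 0; the case
    distinction delays it by one stage to obtain \<open>Dn_0\<close>.\<close>
  define Dn where "Dn t p = (if t = 0 then 0 else eval_within f t [p, 0])" for t p
  have "kolmogorov D Dn"
  proof
    show "Dn t' p = Dn t p" if "Dn t p \<noteq> 0" "t \<le> t'" for t p t'
      using that eval_within_mono[of f t "[p, 0]" t'] by (auto simp: Dn_def split: if_splits)
    show "D (n2s p) [] = Some (n2s z) \<longleftrightarrow> (\<exists>t. Dn t p = Suc z)" for p z
    proof -
      have "D (n2s p) [] = Some (n2s z) \<longleftrightarrow> (\<exists>t. eval_within f t [p, 0] = Suc z)"
        using f[of "n2s p" "[]" z] by (simp add: eval_iff_eval_within)
      also have "\<dots> \<longleftrightarrow> (\<exists>t. Dn t p = Suc z)"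
      proof
        assume "\<exists>t. eval_within f t [p, 0] = Suc z"
        then obtain t where "eval_within f t [p, 0] = Suc z" ..
        then have "Dn (Suc t) p = Suc z"
          using eval_within_mono[of f t "[p, 0]" "Suc t"] by (simp add: Dn_def)
        then show "\<exists>t. Dn t p = Suc z" ..
      next
        assume "\<exists>t. Dn t p = Suc z"
        then obtain t where "Dn t p = Suc z" ..
        then have "eval_within f t [p, 0] = Suc z" by (simp add: Dn_def split: if_splits)
        then show "\<exists>t. eval_within f t [p, 0] = Suc z" ..
      qed
      finally show ?thesis .
    qed
    have "total_comp 3 (\<lambda>ys. eval_within f (hd ys) (tl ys))" using total_comp_eval_within[of 2 f] by (simp add: eval_nat_numeral)
    then have "total_comp 2 (\<lambda>xs. (\<lambda>ys. eval_within f (hd ys) (tl ys)) (map (\<lambda>G. G xs) [hd, \<lambda>xs. hd (tl xs), \<lambda>xs. 0]))"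
      by (intro total_comp_comp_list) (auto simp: eval_nat_numeral intro: total_comp_vars total_comp_const)
    then have "total_comp 2 (\<lambda>xs. eval_within f (hd xs) [hd (tl xs), 0])" by simp
    then show "total_comp 2 (\<lambda>xs. Dn (hd xs) (hd (tl xs)))"
      unfolding Dn_def by (intro total_comp_if total_comp_eq total_comp_const total_comp_vars) auto
  qed (use assms in \<open>auto simp: Dn_def\<close>)
  then show ?thesis by blast
qed

context kolmogorov
begin

abbreviation "K m \<equiv> KC D (n2s m) []"

lemma KC_le: "D p y = Some x \<Longrightarrow> KC D x y \<le> length p"
  unfolding KC_def by (rule Least_le) blast

lemma universal_search:
  assumes "total_comp 3 (\<lambda>xs. R (hd xs) (hd (tl xs)) (hd (tl (tl xs))))"
    and "total_comp 3 (\<lambda>xs. H (hd xs) (hd (tl xs)) (hd (tl (tl xs))))"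
  obtains c where "\<And>p. \<exists>p'. length p' \<le> length (n2s p) + c \<and>
    (\<forall>y t. R t p (s2n y) = 0 \<longrightarrow> (\<forall>t'<t. R t' p (s2n y) \<noteq> 0) \<longrightarrow> D p' y = Some (n2s (H t p (s2n y))))"
proof -
  let ?F = "\<lambda>p y. if \<exists>t. R t (s2n p) (s2n y) = 0
    then Some (n2s (H (LEAST t. R t (s2n p) (s2n y) = 0) (s2n p) (s2n y))) else None"
  have "computable2 ?F" by (rule computable2_search[OF assms])
  then have "\<exists>c. \<forall>p. \<exists>p'. length p' \<le> length p + c \<and> (\<forall>z. D p' z = ?F p z)"
    by (rule universal[unfolded universal_def, THEN conjunct2, rule_format])
  then obtain c where c: "\<And>p. \<exists>p'. length p' \<le> length p + c \<and> (\<forall>z. D p' z = ?F p z)"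
    by (elim exE) (rule that, erule spec)
  show thesis
  proof (rule that)
    fix p
    obtain p' where p': "length p' \<le> length (n2s p) + c" "\<And>z. D p' z = ?F (n2s p) z" using c by blast
    have "D p' y = Some (n2s (H t p (s2n y)))" if "R t p (s2n y) = 0" "\<forall>t'<t. R t' p (s2n y) \<noteq> 0" for y t
    proof -
      have "(LEAST t. R t p (s2n y) = 0) = t"
        using that by (intro Least_equality) (auto simp: not_less[symmetric])
      with that(1) show ?thesis unfolding p'(2) by auto
    qed
    with p'(1) show "\<exists>p'. length p' \<le> length (n2s p) + c \<and>
      (\<forall>y t. R t p (s2n y) = 0 \<longrightarrow> (\<forall>t'<t. R t' p (s2n y) \<noteq> 0) \<longrightarrow> D p' y = Some (n2s (H t p (s2n y))))"
      by (intro exI[of _ p'] conjI allI impI)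
  qed
qed

lemma K_search:
  assumes "total_comp 2 (\<lambda>xs. R (hd xs) (hd (tl xs)))" and "total_comp 2 (\<lambda>xs. H (hd xs) (hd (tl xs)))"
  obtains c where "\<And>t p. R t p = 0 \<Longrightarrow> \<forall>t'<t. R t' p \<noteq> 0 \<Longrightarrow> K (H t p) \<le> length (n2s p) + c"
proof -
  have "total_comp 3 (\<lambda>xs. R (hd xs) (hd (tl xs)))" "total_comp 3 (\<lambda>xs. H (hd xs) (hd (tl xs)))"
    by (intro total_comp_comp2[OF assms(1)] total_comp_vars, simp_all) (intro total_comp_comp2[OF assms(2)] total_comp_vars, simp_all)
  from universal_search[of "\<lambda>t p y. R t p" "\<lambda>t p y. H t p", OF this]
  obtain c where c: "\<And>p. \<exists>p'. length p' \<le> length (n2s p) + c \<and>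
    (\<forall>y t. R t p = 0 \<longrightarrow> (\<forall>t'<t. R t' p \<noteq> 0) \<longrightarrow> D p' y = Some (n2s (H t p)))" by blast
  show thesis
  proof (rule that[of c])
    fix t p assume "R t p = 0" "\<forall>t'<t. R t' p \<noteq> 0"
    moreover obtain p' where "length p' \<le> length (n2s p) + c"
      "\<forall>y t. R t p = 0 \<longrightarrow> (\<forall>t'<t. R t' p \<noteq> 0) \<longrightarrow> D p' y = Some (n2s (H t p))"
      using c[of p] by blast
    ultimately show "K (H t p) \<le> length (n2s p) + c"
      using KC_le[of p' "[]" "n2s (H t p)"] by auto
  qed
qed

text \<open>With the constant 0 as search predicate the search ends at once on every condition, so
  the program is total, as \<open>CT\<close> demands.\<close>

lemma universal_total:
  assumes "total_comp 2 (\<lambda>xs. H (hd xs) (hd (tl xs)))"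
  obtains c where "\<And>p. \<exists>p'. length p' \<le> length (n2s p) + c \<and> (\<forall>y. D p' y = Some (n2s (H p (s2n y))))"
proof -
  have H: "total_comp 3 (\<lambda>xs. H (hd (tl xs)) (hd (tl (tl xs))))"
    by (intro total_comp_comp2[OF assms] total_comp_vars) simp_all
  show thesis
  proof (rule universal_search[of "\<lambda>t p y. 0" "\<lambda>t p y. H p y", OF total_comp_const H])
    fix c
    assume c: "\<exists>p'. length p' \<le> length (n2s p) + c \<and>
      (\<forall>y (t::nat). (0::nat) = 0 \<longrightarrow> (\<forall>t'<t. (0::nat) \<noteq> 0) \<longrightarrow> D p' y = Some (n2s (H p (s2n y))))" for p
    show thesis
    proof (rule that[of c])
      fix p
      obtain p' where p': "length p' \<le> length (n2s p) + c"
        "\<forall>y (t::nat). (0::nat) = 0 \<longrightarrow> (\<forall>t'<t. (0::nat) \<noteq> 0) \<longrightarrow> D p' y = Some (n2s (H p (s2n y)))"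
        using c[of p] by (elim exE conjE) (rule that)
      have "D p' y = Some (n2s (H p (s2n y)))" for y
        using p'(2)[rule_format, of 0] by simp
      with p'(1) show "\<exists>p'. length p' \<le> length (n2s p) + c \<and> (\<forall>y. D p' y = Some (n2s (H p (s2n y))))"
        by (intro exI[of _ p'] conjI allI)
    qed
  qed
qed

lemma CT_total:
  assumes "total_comp 2 (\<lambda>xs. H (hd xs) (hd (tl xs)))"
  obtains c where "\<And>p y. CT D (n2s (H p y)) (n2s y) \<le> length (n2s p) + c"
proof -
  show thesis
  proof (rule universal_total[of H, OF assms])
    fix c
    assume c: "\<exists>p'. length p' \<le> length (n2s p) + c \<and> (\<forall>y. D p' y = Some (n2s (H p (s2n y))))" for p
    show thesis
    proof (rule that[of c])
      fix p y
      obtain p' where p': "length p' \<le> length (n2s p) + c" "\<forall>y. D p' y = Some (n2s (H p (s2n y)))"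
        using c[of p] by (elim exE conjE) (rule that)
      have "CT D (n2s (H p y)) (n2s y) \<le> length p'"
        unfolding CT_def by (rule Least_le) (use p' in auto)
      with p' show "CT D (n2s (H p y)) (n2s y) \<le> length (n2s p) + c" by simp
    qed
  qed
qed

text \<open>\<open>KC\<close> is a \<open>LEAST\<close> and means nothing until \<open>m\<close> is
  known to have a program; a decompressor that outputs its own program provides one.\<close>

lemma K_program: obtains p t where "length (n2s p) = K m" "Dn t p = Suc m"
proof -
  have "total_comp 2 (\<lambda>xs. hd xs)" by (intro total_comp_vars) simp
  then obtain c where c: "\<And>p. \<exists>p'. length p' \<le> length (n2s p) + c \<and> (\<forall>y. D p' y = Some (n2s p))"
    by (rule universal_total[of "\<lambda>p y. p"]) (rule that)
  from c[of m] obtain p where "D p [] = Some (n2s m)" by auto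
  then have "\<exists>l p. length p = l \<and> D p [] = Some (n2s m)" by blast
  from LeastI_ex[OF this] obtain p where p: "length p = K m" "D p [] = Some (n2s m)"
    unfolding KC_def by blast
  then obtain t where "Dn t (s2n p) = Suc m" using D_iff[of "s2n p" m] by auto
  with p show thesis by (intro that[of "s2n p" t]) auto
qed

end

section \<open>Self-delimiting codes and complexity bounds\<close>

abbreviation blen :: "nat \<Rightarrow> nat" where "blen m \<equiv> length (n2s m)"

lemma less_power_blen: "m < 2 ^ Suc (blen m)"
  using length_n2s[of m] by linarith

text \<open>The exponent of \<open>2\<close> in the code announces how many binary digits belong to \<open>x\<close>; the pair
  costs \<open>2 blen x\<close> on top of \<open>blen m\<close>.\<close>

definition epair :: "nat \<Rightarrow> nat \<Rightarrow> nat" where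
  "epair x m = 2 ^ Suc (blen x) * Suc (2 * (m * 2 ^ Suc (blen x) + x))"

definition trailing_zeros :: "nat \<Rightarrow> nat" where
  "trailing_zeros p = bleast (\<lambda>w. p mod 2 ^ Suc w \<noteq> 0) p"

definition efst :: "nat \<Rightarrow> nat" where
  "efst p = (p div 2 ^ Suc (trailing_zeros p)) mod 2 ^ trailing_zeros p"

definition esnd :: "nat \<Rightarrow> nat" where
  "esnd p = p div 2 ^ Suc (trailing_zeros p) div 2 ^ trailing_zeros p"

lemma trailing_zeros_odd: "trailing_zeros (2 ^ w * Suc (2 * q)) = w"
  unfolding trailing_zeros_def
proof (rule bleast_eq)
  have "\<not> 2 ^ Suc w dvd (2 ^ w * Suc (2 * q) :: nat)"
    by (simp add: mult.commute[of 2] del: mult_Suc_right)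
  then show "(2 ^ w * Suc (2 * q)) mod 2 ^ Suc w \<noteq> (0::nat)"
    by (simp only: dvd_eq_mod_eq_0 not_False_eq_True)
  have "w < 2 ^ w" by (rule less_exp)
  also have "\<dots> \<le> 2 ^ w * Suc (2 * q)" by simp
  finally show "w < 2 ^ w * Suc (2 * q)" .
  show "\<not> (2 ^ w * Suc (2 * q)) mod 2 ^ Suc j \<noteq> 0" if "j < w" for j
    using that by (auto intro!: dvd_imp_mod_0 dvd_mult2 le_imp_power_dvd simp del: power_Suc mult_Suc_right)
qed

lemma epair_decode [simp]: "efst (epair x m) = x" "esnd (epair x m) = m"
proof -
  let ?w = "Suc (blen x)"
  have trailing_zeros: "trailing_zeros (epair x m) = ?w" unfolding epair_def by (rule trailing_zeros_odd)
  have "epair x m div 2 ^ Suc ?w = m * 2 ^ ?w + x"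
    unfolding epair_def power_Suc2[of 2 ?w] div_mult2_eq by simp
  then show "efst (epair x m) = x" "esnd (epair x m) = m"
    using less_power_blen[of x] unfolding efst_def esnd_def trailing_zeros by simp_all
qed

text \<open>The overhead is \<open>Suc (blen x)\<close> zeros, the separating bit 1 and
  \<open>Suc (blen x)\<close> digits of \<open>x\<close>.\<close>

lemma blen_epair: "blen (epair x m) \<le> blen m + 2 * blen x + 3"
proof -
  let ?w = "Suc (blen x)"
  have "epair x m + 1 \<le> 2 ^ ?w * (2 * (m * 2 ^ ?w + 2 ^ ?w))"
  proof -
    have "Suc (2 * (m * 2 ^ ?w + x)) + 1 \<le> 2 * (m * 2 ^ ?w + 2 ^ ?w)"
    proof -
      have "Suc (2 * (m * W + x)) + 1 \<le> 2 * (m * W + W)" if "x < W" for W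
        using that by (simp add: algebra_simps)
      then show ?thesis using less_power_blen[of x] .
    qed
    then have "2 ^ ?w * (Suc (2 * (m * 2 ^ ?w + x)) + 1) \<le> 2 ^ ?w * (2 * (m * 2 ^ ?w + 2 ^ ?w))"
      by (rule mult_le_mono2)
    moreover have "epair x m + 1 \<le> 2 ^ ?w * (Suc (2 * (m * 2 ^ ?w + x)) + 1)"
      unfolding epair_def by (simp add: algebra_simps del: power_Suc)
    ultimately show ?thesis by linarith
  qed
  also have "\<dots> = 2 ^ (2 * ?w + 1) * (m + 1)"
    by (simp add: power_add power_mult power2_eq_square algebra_simps)
  also have "\<dots> < 2 ^ (2 * ?w + 1) * 2 ^ Suc (blen m)"
    using length_n2s[of m] by (intro mult_strict_left_mono) (auto simp del: power_Suc)
  also have "\<dots> = 2 ^ Suc (blen m + 2 * blen x + 3)"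
    unfolding power_add[symmetric] by (rule arg_cong[of _ _ "(^) 2"]) simp
  finally show ?thesis by (simp only: length_n2s_le)
qed

text \<open>The parameters are charged twice, but the payload \<open>m\<close> at the end only once;
  this matters when it is a number of changes or a shortest program.\<close>

fun encs :: "nat list \<Rightarrow> nat \<Rightarrow> nat" where
  "encs [] m = m"
| "encs (a # as) m = epair a (encs as m)"

definition decs :: "nat \<Rightarrow> nat \<Rightarrow> nat list" where
  "decs r p = map (\<lambda>i. efst ((esnd ^^ i) p)) [0..<r]"

lemma decs_encs: "decs (length as) (encs as m) = as"
proof (induction as)
  case (Cons a as)
  have "[0..<Suc (length as)] = 0 # map Suc [0..<length as]"
    by (simp add: map_Suc_upt upt_conv_Cons del: upt_Suc)
  then have "decs (Suc (length as)) (encs (a # as) m) = a # decs (length as) (encs as m)"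
    unfolding decs_def by (simp add: funpow_swap1 comp_def)
  with Cons show ?case by simp
qed (simp add: decs_def)

lemma esnds_encs: "(esnd ^^ length as) (encs as m) = m"
  by (induction as) (simp_all add: funpow_swap1)

lemma blen_encs: "blen (encs as m) \<le> blen m + 2 * (\<Sum>a\<leftarrow>as. blen a) + 3 * length as"
proof (induction as)
  case (Cons a as)
  with blen_epair[of a "encs as m"] show ?case by simp
qed simp

lemma total_comp_trailing_zeros:
  assumes "total_comp n A" shows "total_comp n (\<lambda>xs. trailing_zeros (A xs))"
proof (rule total_comp_comp1[OF _ assms])
  show "total_comp 1 (\<lambda>xs. trailing_zeros (hd xs))"
    unfolding trailing_zeros_def by (intro total_comp_intros total_comp_vars) simp_all
qed

lemma total_comp_efst: "total_comp n A \<Longrightarrow> total_comp n (\<lambda>xs. efst (A xs))"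
  unfolding efst_def by (intro total_comp_intros total_comp_trailing_zeros)

lemma total_comp_esnd: "total_comp n A \<Longrightarrow> total_comp n (\<lambda>xs. esnd (A xs))"
  unfolding esnd_def by (intro total_comp_intros total_comp_trailing_zeros)

lemma total_comp_esnds: "total_comp n A \<Longrightarrow> total_comp n (\<lambda>xs. (esnd ^^ i) (A xs))"
  by (induction i) (auto intro: total_comp_esnd)

lemma total_comp_decs:
  assumes "total_comp (Suc r) (\<lambda>xs. T (hd xs) (tl xs))" "total_comp n A" "total_comp n B"
  shows "total_comp n (\<lambda>xs. T (A xs) (decs r (B xs)))"
proof -
  let ?Gs = "A # map (\<lambda>i xs. efst ((esnd ^^ i) (B xs))) [0..<r]"
  have "total_comp n (\<lambda>xs. (\<lambda>ys. T (hd ys) (tl ys)) (map (\<lambda>G. G xs) ?Gs))"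
    by (rule total_comp_comp_list) (use assms in \<open>auto intro: total_comp_efst total_comp_esnds\<close>)
  then show ?thesis by (simp add: decs_def comp_def)
qed

section \<open>Values determined by a count of changes\<close>

definition changes :: "(nat \<Rightarrow> nat) \<Rightarrow> nat \<Rightarrow> nat" where
  "changes h t = (\<Sum>i<t. of_bool (h (Suc i) \<noteq> h i))"

lemma changes_mono: "s \<le> t \<Longrightarrow> changes h s \<le> changes h t"
  unfolding changes_def by (rule sum_mono2) auto

lemma changes_eq: "s \<le> t \<Longrightarrow> changes h s = changes h t \<Longrightarrow> h s = h t"
proof (induction t rule: dec_induct)
  case (step t)
  have "changes h (Suc t) = changes h t + of_bool (h (Suc t) \<noteq> h t)" by (simp add: changes_def)
  with step changes_mono[of s t h] show ?case by (cases "h (Suc t) = h t") auto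
qed simp

context kolmogorov
begin

text \<open>The count of changes determines the value: simulate until that many changes have been
  seen. It replaces the stage \<open>t\<close>, which may be enormous, in the description.\<close>

lemma K_changes:
  assumes h: "total_comp (Suc r) (\<lambda>xs. h (hd xs) (tl xs))"
  obtains c where "\<And>as t. length as = r \<Longrightarrow>
    K (h t as) \<le> blen (changes (\<lambda>t. h t as) t) + 2 * (\<Sum>a\<leftarrow>as. blen a) + c"
proof -
  have "total_comp (Suc (Suc r)) (\<lambda>us. (\<lambda>ys. h (hd ys) (tl ys)) (map (\<lambda>G. G us) [\<lambda>us. Suc (hd us)] @ (tl ^^ 2) us))"
    by (intro total_comp_Cons_comp[of 1 r]) (use h in \<open>auto intro: total_comp_Suc total_comp_vars\<close>)
  moreover have "total_comp (Suc (Suc r)) (\<lambda>us. (\<lambda>ys. h (hd ys) (tl ys)) (map (\<lambda>G. G us) [hd] @ (tl ^^ 2) us))"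
    by (intro total_comp_Cons_comp[of 1 r]) (use h in \<open>auto intro: total_comp_vars\<close>)
  ultimately have "total_comp (Suc (Suc r)) (\<lambda>us. of_bool (h (Suc (hd us)) (tl (tl us)) \<noteq> h (hd us) (tl (tl us))))"
    by (intro total_comp_not total_comp_eq) (simp_all add: numeral_2_eq_2)
  then have ch: "total_comp (Suc r) (\<lambda>ys. changes (\<lambda>t. h t (tl ys)) (hd ys))"
    unfolding changes_def by (intro total_comp_sum total_comp_vars) simp_all
  have R: "total_comp 2 (\<lambda>xs. of_bool (changes (\<lambda>t. h t (decs r (hd (tl xs)))) (hd xs) \<noteq> (esnd ^^ r) (hd (tl xs))))"
    by (intro total_comp_not total_comp_eq total_comp_decs[where T = "\<lambda>s as. changes (\<lambda>t. h t as) s", OF ch] total_comp_esnds total_comp_vars) simp_all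
  have H: "total_comp 2 (\<lambda>xs. h (hd xs) (decs r (hd (tl xs))))"
    by (intro total_comp_decs[where T = h, OF h] total_comp_vars) simp_all
  show thesis
  proof (rule K_search[of "\<lambda>t p. of_bool (changes (\<lambda>t. h t (decs r p)) t \<noteq> (esnd ^^ r) p)"
        "\<lambda>t p. h t (decs r p)", OF R H])
    fix c
    assume c: "of_bool (changes (\<lambda>t. h t (decs r p)) t \<noteq> (esnd ^^ r) p) = (0::nat) \<Longrightarrow>
      \<forall>t'<t. of_bool (changes (\<lambda>t. h t (decs r p)) t' \<noteq> (esnd ^^ r) p) \<noteq> (0::nat) \<Longrightarrow>
      K (h t (decs r p)) \<le> blen p + c" for t p
    show thesis
    proof (rule that[of "3 * r + c"])
      fix as :: "nat list" and t assume len: "length as = r"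
      define j where "j = changes (\<lambda>t. h t as) t"
      define p where "p = encs as j"
      define s where "s = (LEAST s. changes (\<lambda>t. h t as) s = j)"
      have s: "changes (\<lambda>t. h t as) s = j" "s \<le> t"
        unfolding s_def by (rule LeastI[of _ t], simp add: j_def, rule Least_le, simp add: j_def)
      have [simp]: "decs r p = as" "(esnd ^^ r) p = j"
        using decs_encs[of as j] esnds_encs[of as j] len by (simp_all add: p_def)
      have "K (h s as) \<le> blen p + c"
      proof -
        have "\<forall>t'<s. changes (\<lambda>t. h t as) t' \<noteq> j"
          unfolding s_def by (intro allI impI) (rule not_less_Least)
        with c[of p s] s(1) show ?thesis by simp
      qed
      moreover have "h s as = h t as"
        using changes_eq[of s t "\<lambda>t. h t as"] s j_def by simp
      moreover have "blen p \<le> blen j + 2 * (\<Sum>a\<leftarrow>as. blen a) + 3 * r"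
        using blen_encs[of as j] len by (simp add: p_def)
      ultimately show "K (h t as) \<le> blen (changes (\<lambda>t. h t as) t) + 2 * (\<Sum>a\<leftarrow>as. blen a) + (3 * r + c)"
        by (simp add: j_def)
    qed
  qed
qed

lemma K_image:
  assumes T: "total_comp (Suc r) (\<lambda>xs. T (hd xs) (tl xs))"
  obtains c where "\<And>as m. length as = r \<Longrightarrow> K (T m as) \<le> K m + 2 * (\<Sum>a\<leftarrow>as. blen a) + c"
proof -
  have D: "total_comp 2 (\<lambda>xs. Dn (hd xs) ((esnd ^^ r) (hd (tl xs))))"
    by (intro total_comp_comp2[OF total_comp_Dn] total_comp_esnds total_comp_vars) simp_all
  have R: "total_comp 2 (\<lambda>xs. of_bool (Dn (hd xs) ((esnd ^^ r) (hd (tl xs))) = 0))"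
    by (intro total_comp_eq total_comp_const D)
  have H: "total_comp 2 (\<lambda>xs. T (Dn (hd xs) ((esnd ^^ r) (hd (tl xs))) - 1) (decs r (hd (tl xs))))"
    by (intro total_comp_decs[where T = T, OF T] total_comp_diff total_comp_const D total_comp_vars) simp_all
  show thesis
  proof (rule K_search[of "\<lambda>t p. of_bool (Dn t ((esnd ^^ r) p) = 0)"
        "\<lambda>t p. T (Dn t ((esnd ^^ r) p) - 1) (decs r p)", OF R H])
    fix c
    assume c: "of_bool (Dn t ((esnd ^^ r) p) = 0) = (0::nat) \<Longrightarrow>
      \<forall>t'<t. of_bool (Dn t' ((esnd ^^ r) p) = 0) \<noteq> (0::nat) \<Longrightarrow>
      K (T (Dn t ((esnd ^^ r) p) - 1) (decs r p)) \<le> blen p + c" for t p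
    show thesis
    proof (rule that[of "3 * r + c"])
      fix as :: "nat list" and m assume len: "length as = r"
      obtain q u where q: "blen q = K m" "Dn u q = Suc m" by (rule K_program)
      define p where "p = encs as q"
      define s where "s = (LEAST s. Dn s q \<noteq> 0)"
      have s: "Dn s q \<noteq> 0" "s \<le> u"
        unfolding s_def by (rule LeastI[of _ u], simp add: q, rule Least_le, simp add: q)
      then have sm: "Dn s q = Suc m" using Dn_mono[of s q u] q by simp
      have [simp]: "decs r p = as" "(esnd ^^ r) p = q"
        using decs_encs[of as q] esnds_encs[of as q] len by (simp_all add: p_def)
      have "K (T m as) \<le> blen p + c"
      proof -
        have "\<forall>t'<s. \<not> Dn t' q \<noteq> 0"
          unfolding s_def by (intro allI impI) (rule not_less_Least)
        with c[of s p] sm show ?thesis by simp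
      qed
      moreover have "blen p \<le> blen q + 2 * (\<Sum>a\<leftarrow>as. blen a) + 3 * r"
        using blen_encs[of as q] len by (simp add: p_def)
      ultimately show "K (T m as) \<le> K m + 2 * (\<Sum>a\<leftarrow>as. blen a) + (3 * r + c)"
        by (simp add: q)
    qed
  qed
qed

lemma CT_image:
  assumes T: "total_comp (Suc r) (\<lambda>xs. T (hd xs) (tl xs))"
  obtains c where "\<And>as m. length as = r \<Longrightarrow>
    CT D (n2s (T m as)) (n2s m) \<le> 2 * (\<Sum>a\<leftarrow>as. blen a) + c"
proof -
  have H: "total_comp 2 (\<lambda>xs. T (hd (tl xs)) (decs r (hd xs)))"
    by (intro total_comp_decs[where T = T, OF T] total_comp_vars) simp_all
  show thesis
  proof (rule CT_total[of "\<lambda>p y. T y (decs r p)", OF H])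
    fix c assume c: "CT D (n2s (T y (decs r p))) (n2s y) \<le> blen p + c" for p y
    show thesis
    proof (rule that[of "3 * r + c"])
      fix as :: "nat list" and m assume "length as = r"
      with c[of m "encs as 0"] blen_encs[of as 0] decs_encs[of as 0]
      show "CT D (n2s (T m as)) (n2s m) \<le> 2 * (\<Sum>a\<leftarrow>as. blen a) + (3 * r + c)"
        by simp
    qed
  qed
qed

end

section \<open>A covering game on the binary tree\<close>

text \<open>The nodes of the binary tree are the positive integers, with parent map \<open>v \<mapsto> v div 2\<close> and root
  \<open>1\<close>; the leaves below the node \<open>v\<close> of height \<open>b\<close> are \<open>v * 2 ^ b + i\<close> with \<open>i < 2 ^ b\<close>. A node of
  height \<open>b\<close> is abandoned when the covered fraction of its leaves exceeds \<open>(N + 1 - b) / (N + 2)\<close>, and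
  its replacement may have at most the fraction \<open>(N - b) / (N + 2)\<close>. The gap between the two
  thresholds is what makes every change cost a fixed amount of newly covered leaves.\<close>

definition cover_count :: "(nat \<Rightarrow> bool) \<Rightarrow> nat \<Rightarrow> nat \<Rightarrow> nat" where
  "cover_count C b v = (\<Sum>i<2^b. of_bool (C (v * 2 ^ b + i)))"

definition violated :: "(nat \<Rightarrow> bool) \<Rightarrow> nat \<Rightarrow> nat \<Rightarrow> nat \<Rightarrow> bool" where
  "violated C N x b \<longleftrightarrow> (N + 1 - b) * 2 ^ b < (N + 2) * cover_count C b (x div 2 ^ b)"

definition fresh :: "(nat \<Rightarrow> bool) \<Rightarrow> nat \<Rightarrow> nat \<Rightarrow> nat \<Rightarrow> bool" where
  "fresh C N x b \<longleftrightarrow> (N + 2) * cover_count C b (x div 2 ^ b) \<le> (N - b) * 2 ^ b"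

text \<open>A move replaces the whole path below the highest violated node, so all heights from
  there down have to be fresh afterwards, violated or not; otherwise a node could be entered that is
  nearly violated already.\<close>

definition game_step :: "(nat \<Rightarrow> bool) \<Rightarrow> nat \<Rightarrow> nat \<Rightarrow> nat \<Rightarrow> bool" where
  "game_step C N x y \<longleftrightarrow> (\<forall>b<Suc N. (\<exists>c<Suc N. b \<le> c \<and> violated C N x c) \<and> fresh C N y b
     \<or> \<not> (\<exists>c<Suc N. b \<le> c \<and> violated C N x c) \<and> y div 2 ^ b = x div 2 ^ b)"

definition run :: "(nat \<Rightarrow> nat \<Rightarrow> bool) \<Rightarrow> nat \<Rightarrow> nat \<Rightarrow> nat" where
  "run C N t = rec_nat (2 ^ N) (\<lambda>t x. bleast (game_step (C t) N x) (2 ^ Suc N)) t"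

lemma run_0: "run C N 0 = 2 ^ N"
  and run_Suc: "run C N (Suc t) = bleast (game_step (C t) N (run C N t)) (2 ^ Suc N)"
  by (simp_all add: run_def)

lemma cover_count_Suc: "cover_count C (Suc b) v = cover_count C b (2 * v) + cover_count C b (2 * v + 1)"
proof -
  have "(\<Sum>i<2^b + 2^b. f i) = (\<Sum>i<2^b. f i) + (\<Sum>i<2^b. f (2^b + i))" for f :: "nat \<Rightarrow> nat"
  proof -
    have "(\<Sum>i<m + k. f i) = (\<Sum>i<m. f i) + (\<Sum>i<k. f (m + i))" for m k
      by (induction k) auto
    then show ?thesis .
  qed
  then show ?thesis by (simp add: cover_count_def algebra_simps mult_2)
qed

text \<open>By averaging, one of the two children has at most the covered fraction of its parent;
  following such children down keeps the bound at all heights.\<close>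

lemma descend:
  assumes "(N + 2) * cover_count C b v \<le> M * 2 ^ b"
  shows "\<exists>x. x div 2 ^ b = v \<and> (\<forall>c\<le>b. (N + 2) * cover_count C c (x div 2 ^ c) \<le> M * 2 ^ c)"
  using assms
proof (induction b arbitrary: v)
  case (Suc b)
  have "(N + 2) * cover_count C b (2 * v) + (N + 2) * cover_count C b (2 * v + 1) \<le> M * 2 ^ b + M * 2 ^ b"
    using Suc.prems unfolding cover_count_Suc by (simp add: algebra_simps)
  then have "(N + 2) * cover_count C b (2 * v) \<le> M * 2 ^ b \<or> (N + 2) * cover_count C b (2 * v + 1) \<le> M * 2 ^ b"
    by linarith
  then obtain w where w: "w div 2 = v" "(N + 2) * cover_count C b w \<le> M * 2 ^ b"
    by (elim disjE) (rule that[of "2 * v"], simp_all, rule that[of "2 * v + 1"], simp_all)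
  then obtain x where x: "x div 2 ^ b = w" "\<forall>c\<le>b. (N + 2) * cover_count C c (x div 2 ^ c) \<le> M * 2 ^ c"
    using Suc.IH by blast
  have "x div 2 ^ Suc b = v" using x(1) w(1) by (simp only: power_Suc2 div_mult2_eq)
  then show ?case using x(2) Suc.prems by (auto simp: le_Suc_eq)
qed auto

text \<open>\<open>Psi b\<close> is a budget: coverage below a node of height \<open>b\<close> grows
  no faster than \<open>Psi b\<close>. This holds for every node, so it does not matter where the
  play is. \<open>root\<close> prevents the root from being violated.\<close>

locale game =
  fixes N :: nat and C :: "nat \<Rightarrow> nat \<Rightarrow> bool" and Psi :: "nat \<Rightarrow> nat \<Rightarrow> nat"
  assumes cover_mono: "C t v \<Longrightarrow> t \<le> t' \<Longrightarrow> C t' v"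
    and Psi_0: "cover_count (C 0) b v \<le> Psi b 0"
    and growth: "cover_count (C (Suc t)) b v + Psi b t \<le> cover_count (C t) b v + Psi b (Suc t)"
    and root: "(N + 2) * cover_count (C t) N 1 \<le> 2 ^ N"
begin

text \<open>The parent of the highest violated node, of height \<open>b\<close>, is not violated.
  This bounds the covered fraction there by (N - b) / (N + 2), which is the freshness bound at
  \<open>b\<close> and stronger than the one at lower heights, so descending from the parent gives a
  legal move.\<close>

lemma ex_game_step:
  assumes x: "x div 2 ^ N = 1"
  shows "\<exists>y<2 ^ Suc N. game_step (C t) N x y"
proof (cases "\<exists>c<Suc N. violated (C t) N x c")
  case False
  have "x < 2 ^ Suc N" using x by (simp add: div_nat_eqI div_eq_dividend_iff) (metis One_nat_def div_less_iff_less_mult less_2_cases_iff mult_2 lessI numeral_2_eq_2 zero_less_power pos2)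
  with False show ?thesis unfolding game_step_def by blast
next
  case True
  define b where "b = Max {c. c < Suc N \<and> violated (C t) N x c}"
  have "b \<in> {c. c < Suc N \<and> violated (C t) N x c}"
    unfolding b_def by (rule Max_in) (use True in auto)
  then have b: "b \<le> N" "violated (C t) N x b" by auto
  have max: "c \<le> b" if "c < Suc N" "violated (C t) N x c" for c
    unfolding b_def by (rule Max_ge) (use that in auto)
  have "\<not> violated (C t) N x N" using root[of t] x by (simp add: violated_def)
  with b have bN: "b < N" by (metis le_neq_implies_less)
  then have "\<not> violated (C t) N x (Suc b)" using max[of "Suc b"] by auto
  then have "(N + 2) * cover_count (C t) (Suc b) (x div 2 ^ Suc b) \<le> (N - b) * 2 ^ Suc b"
    by (simp add: violated_def not_less)
  then obtain y where y: "y div 2 ^ Suc b = x div 2 ^ Suc b"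
      "\<forall>c\<le>Suc b. (N + 2) * cover_count (C t) c (y div 2 ^ c) \<le> (N - b) * 2 ^ c"
    using descend by blast
  have same: "y div 2 ^ c = x div 2 ^ c" if "b < c" for c
  proof -
    have "y div 2 ^ (Suc b + (c - Suc b)) = x div 2 ^ (Suc b + (c - Suc b))"
      unfolding power_add div_mult2_eq y(1) ..
    with that show ?thesis by simp
  qed
  have "game_step (C t) N x y"
    unfolding game_step_def
  proof (intro allI impI)
    fix c assume c: "c < Suc N"
    show "(\<exists>d<Suc N. c \<le> d \<and> violated (C t) N x d) \<and> fresh (C t) N y c
      \<or> \<not> (\<exists>d<Suc N. c \<le> d \<and> violated (C t) N x d) \<and> y div 2 ^ c = x div 2 ^ c"
    proof (cases "c \<le> b")
      case True
      have "(N + 2) * cover_count (C t) c (y div 2 ^ c) \<le> (N - b) * 2 ^ c" using y(2) True by simp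
      also have "\<dots> \<le> (N - c) * 2 ^ c" using True by (intro mult_le_mono1) auto
      finally have "fresh (C t) N y c" unfolding fresh_def .
      then show ?thesis using b True le_imp_less_Suc by blast
    next
      case False
      then have "\<not> (\<exists>d<Suc N. c \<le> d \<and> violated (C t) N x d)" using max by fastforce
      then show ?thesis using same[of c] False by simp
    qed
  qed
  moreover have "y < 2 ^ Suc N"
  proof -
    have "y div 2 ^ N = 1" using same[OF bN] x by simp
    then show ?thesis by (metis div_less_iff_less_mult less_2_cases_iff One_nat_def power_Suc zero_less_power pos2)
  qed
  ultimately show ?thesis by blast
qed

lemma run_range: "run C N t div 2 ^ N = 1"
  and run_step: "game_step (C t) N (run C N t) (run C N (Suc t))"
proof -
  have step: "game_step (C t) N (run C N t) (run C N (Suc t))" if "run C N t div 2 ^ N = 1" for t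
    unfolding run_Suc using ex_game_step[OF that, of t] bleast(1)[of "game_step (C t) N (run C N t)"] by blast
  show range: "run C N t div 2 ^ N = 1" for t
  proof (induction t)
    case (Suc t)
    have "\<not> violated (C t) N (run C N t) N" using root[of t] Suc by (simp add: violated_def)
    then have "\<not> (\<exists>c<Suc N. N \<le> c \<and> violated (C t) N (run C N t) c)" by (metis le_less_Suc_eq)
    then show ?case using step[OF Suc] Suc unfolding game_step_def by (metis lessI)
  qed (simp add: run_0)
  then show "game_step (C t) N (run C N t) (run C N (Suc t))" by (rule step)
qed

definition violations :: "nat \<Rightarrow> nat \<Rightarrow> nat" where
  "violations b t = (\<Sum>i<t. of_bool (violated (C i) N (run C N i) b))"

text \<open>The two thresholds at height \<open>b\<close> differ by \<open>2 ^ b\<close>. So a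
  violation finds an excess of at least \<open>2 ^ b\<close> over the freshness bound and resets it
  to 0, while otherwise the excess grows no faster than \<open>(N + 2) * Psi b\<close>.\<close>

lemma potential:
  assumes "b \<le> N"
  shows "2 ^ b * violations b t + ((N + 2) * cover_count (C t) b (run C N t div 2 ^ b) - (N - b) * 2 ^ b) \<le> (N + 2) * Psi b t"
proof (induction t)
  case 0
  have "(N + 2) * cover_count (C 0) b (run C N 0 div 2 ^ b) \<le> (N + 2) * Psi b 0"
    by (intro mult_le_mono2 Psi_0)
  then show ?case by (simp add: violations_def)
next
  case (Suc t)
  let ?x = "run C N t" and ?y = "run C N (Suc t)"
  let ?d = "(N - b) * 2 ^ b"
  have vS: "violations b (Suc t) = violations b t + of_bool (violated (C t) N ?x b)" by (simp add: violations_def)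
  have "2 ^ b * violations b (Suc t) + ((N + 2) * cover_count (C t) b (?y div 2 ^ b) - ?d) \<le> (N + 2) * Psi b t"
  proof (cases "\<exists>c<Suc N. b \<le> c \<and> violated (C t) N ?x c")
    case True
    then have f: "(N + 2) * cover_count (C t) b (?y div 2 ^ b) - ?d = 0"
      using run_step[of t] assms unfolding game_step_def fresh_def by (metis diff_is_0_eq le_imp_less_Suc)
    show ?thesis
    proof (cases "violated (C t) N ?x b")
      case True
      have "(N + 1 - b) * 2 ^ b = ?d + 2 ^ b" using assms by (simp add: Suc_diff_le)
      then have "?d + 2 ^ b < (N + 2) * cover_count (C t) b (?x div 2 ^ b)"
        using True unfolding violated_def by linarith
      then have "2 ^ b \<le> (N + 2) * cover_count (C t) b (?x div 2 ^ b) - ?d" by linarith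
      then show ?thesis using Suc True f vS by (simp add: algebra_simps)
    qed (use Suc f vS in simp)
  next
    case False
    then have "?y div 2 ^ b = ?x div 2 ^ b" "\<not> violated (C t) N ?x b"
      using run_step[of t] assms unfolding game_step_def by (metis le_imp_less_Suc, metis le_imp_less_Suc order_refl)
    then show ?thesis using Suc vS by simp
  qed
  moreover have "(N + 2) * (cover_count (C (Suc t)) b (?y div 2 ^ b) + Psi b t) \<le>
      (N + 2) * (cover_count (C t) b (?y div 2 ^ b) + Psi b (Suc t))"
    by (intro mult_le_mono2 growth)
  moreover have "(N + 2) * cover_count (C t) b (?y div 2 ^ b) \<le> (N + 2) * cover_count (C (Suc t)) b (?y div 2 ^ b)"
    unfolding cover_count_def by (intro mult_le_mono2 sum_mono) (auto intro: cover_mono)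
  moreover have "a + (u - d) \<le> p \<Longrightarrow> u' + p \<le> u + p' \<Longrightarrow> u \<le> u' \<Longrightarrow> a + (u' - d) \<le> p'" for a u u' d p p' :: nat
    by linarith
  ultimately show ?case unfolding distrib_left by blast
qed

text \<open>A node of height \<open>b\<close> changes only when some height from \<open>b\<close> up
  is violated, and \<open>potential\<close> bounds the violations at each of these at most
  \<open>N + 1\<close> heights.\<close>

lemma changes_run_le:
  assumes "b \<le> N" "\<And>c. b \<le> c \<Longrightarrow> c \<le> N \<Longrightarrow> Psi c t \<le> M * 2 ^ c"
  shows "changes (\<lambda>t. run C N t div 2 ^ b) t \<le> (N + 1) * ((N + 2) * M)"
proof -
  have v: "violations c t \<le> (N + 2) * M" if "c \<in> {b..N}" for c
  proof -
    have "2 ^ c * violations c t \<le> (N + 2) * Psi c t" using potential[of c t] that by simp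
    also have "\<dots> \<le> (N + 2) * (M * 2 ^ c)" using assms(2)[of c] that by (intro mult_le_mono2) auto
    finally have "2 ^ c * violations c t \<le> 2 ^ c * ((N + 2) * M)" by (simp add: algebra_simps)
    then show ?thesis by simp
  qed
  have one: "of_bool (run C N (Suc i) div 2 ^ b \<noteq> run C N i div 2 ^ b)
      \<le> (\<Sum>c\<in>{b..N}. of_bool (violated (C i) N (run C N i) c) :: nat)" for i
  proof (cases "\<exists>c<Suc N. b \<le> c \<and> violated (C i) N (run C N i) c")
    case True
    then obtain c where c: "c \<in> {b..N}" "violated (C i) N (run C N i) c" by (auto simp: less_Suc_eq_le)
    have "(of_bool (violated (C i) N (run C N i) c) :: nat) \<le> (\<Sum>c\<in>{b..N}. of_bool (violated (C i) N (run C N i) c))"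
      using c(1) by (intro member_le_sum) auto
    with c(2) have "1 \<le> (\<Sum>c\<in>{b..N}. of_bool (violated (C i) N (run C N i) c) :: nat)"
      by (simp only: of_bool_eq)
    moreover have "(of_bool Q :: nat) \<le> 1" for Q by simp
    ultimately show ?thesis by (meson le_trans)
  next
    case False
    then have "run C N (Suc i) div 2 ^ b = run C N i div 2 ^ b"
      using run_step[of i] assms unfolding game_step_def by (metis le_imp_less_Suc)
    then show ?thesis by simp
  qed
  have "changes (\<lambda>t. run C N t div 2 ^ b) t \<le> (\<Sum>i<t. \<Sum>c\<in>{b..N}. of_bool (violated (C i) N (run C N i) c))"
    unfolding changes_def by (intro sum_mono one)
  also have "\<dots> = (\<Sum>c\<in>{b..N}. violations c t)" unfolding violations_def by (rule sum.swap)
  also have "\<dots> \<le> (\<Sum>c\<in>{b..N}. (N + 2) * M)" by (intro sum_mono v)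
  also have "\<dots> \<le> (N + 1) * ((N + 2) * M)"
    unfolding sum_constant by (intro mult_le_mono1) simp
  finally show ?thesis .
qed

text \<open>The leaf changes boundedly often, so the run becomes constant. A covered leaf is
  violated at height 0 and has to be followed by a fresh leaf, which is a different one.\<close>

lemma run_limit:
  assumes "\<And>c t. c \<le> N \<Longrightarrow> Psi c t \<le> M * 2 ^ c"
  obtains T where "\<And>t. T \<le> t \<Longrightarrow> run C N t = run C N T" "\<And>t. \<not> C t (run C N T)"
proof -
  let ?S = "range (changes (run C N))"
  have "changes (run C N) t \<le> (N + 1) * ((N + 2) * M)" for t
    using changes_run_le[of 0 t M] assms by simp
  then have fin: "finite ?S" by (intro finite_subset[OF _ finite_atMost]) auto
  then have "Max ?S \<in> ?S" by (intro Max_in) auto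
  then obtain T where T: "changes (run C N) T = Max ?S" by auto
  have stable: "run C N t = run C N T" if "T \<le> t" for t
  proof -
    have "changes (run C N) t \<le> Max ?S" using fin by (intro Max_ge) auto
    then have "changes (run C N) T = changes (run C N) t" using changes_mono[OF that] T by (metis le_antisym)
    from changes_eq[OF that this] show ?thesis by simp
  qed
  have not: "\<not> C t (run C N T)" if "T \<le> t" for t
  proof
    assume "C t (run C N T)"
    then have v: "violated (C t) N (run C N T) 0" by (simp add: violated_def cover_count_def)
    then have "fresh (C t) N (run C N T) 0"
      using run_step[of t] stable[OF that] stable[of "Suc t"] that unfolding game_step_def by auto
    with v show False by (simp add: violated_def fresh_def)
  qed
  have "\<not> C t (run C N T)" for t
    using not[of "max t T"] cover_mono[of t "run C N T" "max t T"] by auto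
  with stable that show thesis by blast
qed

end

section \<open>Covering by simple sets\<close>

text \<open>The cardinality of the set coded by \<open>z\<close>, as a bounded sum so that it is
  computable; positions from \<open>z\<close> on carry no bit since
  \<open>z < 2 ^ z\<close>.\<close>

definition popcount :: "nat \<Rightarrow> nat" where
  "popcount z = (\<Sum>i<z. z div 2 ^ i mod 2)"

lemma set_decode_less: "i \<in> set_decode z \<Longrightarrow> i < z"
proof -
  assume "i \<in> set_decode z"
  then have "z div 2 ^ i \<noteq> 0" by (auto simp: set_decode_def elim!: oddE)
  then have "2 ^ i \<le> z" by (metis div_less not_le)
  then show ?thesis using less_exp[of i] by linarith
qed

lemma popcount_eq_card: "popcount z = card (set_decode z)"
proof -
  have "popcount z = (\<Sum>i<z. of_bool (i \<in> set_decode z))"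
    unfolding popcount_def by (intro sum.cong) (auto simp: set_decode_def odd_iff_mod_2_eq_one)
  also have "\<dots> = card ({..<z} \<inter> set_decode z)" by (simp add: sum_of_bool_eq)
  also have "{..<z} \<inter> set_decode z = set_decode z" using set_decode_less by auto
  finally show ?thesis .
qed

lemma total_comp_popcount:
  assumes "total_comp n A" shows "total_comp n (\<lambda>xs. popcount (A xs))"
proof (rule total_comp_comp1[OF _ assms])
  show "total_comp 1 (\<lambda>xs. popcount (hd xs))" unfolding popcount_def by (intro total_comp_intros total_comp_vars) simp_all
qed

lemma cover_count_card: "cover_count C b v = card {y \<in> {v * 2 ^ b..<v * 2 ^ b + 2 ^ b}. C y}"
proof -
  have "cover_count C b v = card ({..<2 ^ b} \<inter> {i. C (v * 2 ^ b + i)})"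
    unfolding cover_count_def by (simp add: sum_of_bool_eq)
  also have "\<dots> = card ((\<lambda>i. v * 2 ^ b + i) ` ({..<2 ^ b} \<inter> {i. C (v * 2 ^ b + i)}))"
    by (rule card_image[symmetric]) (auto intro: inj_onI)
  also have "(\<lambda>i. v * 2 ^ b + i) ` ({..<2 ^ b} \<inter> {i. C (v * 2 ^ b + i)}) = {y \<in> {v * 2 ^ b..<v * 2 ^ b + 2 ^ b}. C y}"
  proof (intro set_eqI iffI)
    fix y assume y: "y \<in> {y \<in> {v * 2 ^ b..<v * 2 ^ b + 2 ^ b}. C y}"
    then show "y \<in> (\<lambda>i. v * 2 ^ b + i) ` ({..<2 ^ b} \<inter> {i. C (v * 2 ^ b + i)})"
      by (intro image_eqI[of _ _ "y - v * 2 ^ b"]) auto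
  qed auto
  finally show ?thesis .
qed

context kolmogorov
begin

text \<open>A string of length \<open>n = N + S\<close> with number \<open>w\<close> lies below the leaf \<open>(w + 1) div 2 ^ S\<close> of a tree
  of height \<open>N\<close>. A leaf is covered by \<open>small_cover\<close> if some set of at most \<open>2 ^ b\<close> strings with
  complexity below \<open>g b\<close> meets it, and by \<open>full_cover\<close> if all its extensions have complexity below \<open>l\<close>.\<close>

definition small_cover :: "(nat \<Rightarrow> nat) \<Rightarrow> nat \<Rightarrow> nat \<Rightarrow> nat \<Rightarrow> nat \<Rightarrow> bool" where
  "small_cover g N S t v \<longleftrightarrow> (\<exists>b<Suc N. \<exists>p<2 ^ g b - 1. \<exists>r<2 ^ S.
     Dn t p \<noteq> 0 \<and> popcount (Dn t p - 1) \<le> 2 ^ b \<and> (Dn t p - 1) div 2 ^ (v * 2 ^ S + r - 1) mod 2 = 1)"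

definition full_cover :: "nat \<Rightarrow> nat \<Rightarrow> nat \<Rightarrow> nat \<Rightarrow> bool" where
  "full_cover l S t v \<longleftrightarrow> (\<forall>r<2 ^ S. \<exists>p<2 ^ l - 1. Dn t p = Suc (v * 2 ^ S + r - 1))"

text \<open>For \<open>v = 0\<close> the truncated subtraction in \<open>v * 2 ^ S + r - 1\<close>
  would identify \<open>r = 0\<close> with \<open>r = 1\<close>; \<open>0 < v\<close> excludes
  this.\<close>

definition covered :: "(nat \<Rightarrow> nat) \<Rightarrow> nat \<Rightarrow> nat \<Rightarrow> nat \<Rightarrow> nat \<Rightarrow> nat \<Rightarrow> bool" where
  "covered g N S l t v \<longleftrightarrow> 0 < v \<and> (small_cover g N S t v \<or> full_cover l S t v)"

text \<open>The numbers below \<open>2 ^ l - 1\<close> are those of the strings shorter than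
  \<open>l\<close>, so these are programs shorter than \<open>g b\<close>.\<close>

definition halted :: "(nat \<Rightarrow> nat) \<Rightarrow> nat \<Rightarrow> nat \<Rightarrow> nat set" where
  "halted g t b = {p. p < 2 ^ g b - 1 \<and> Dn t p \<noteq> 0}"

definition full :: "nat \<Rightarrow> nat \<Rightarrow> nat \<Rightarrow> nat set" where
  "full l S t = {v. 0 < v \<and> full_cover l S t v}"

text \<open>The potential of the game at height \<open>b\<close>: a set counted at level \<open>c\<close> covers at most
  \<open>min (2 ^ c) (2 ^ b)\<close> leaves below one node of height \<open>b\<close>.\<close>

definition Psi :: "(nat \<Rightarrow> nat) \<Rightarrow> nat \<Rightarrow> nat \<Rightarrow> nat \<Rightarrow> nat \<Rightarrow> nat \<Rightarrow> nat" where
  "Psi g N S l b t = (\<Sum>c<Suc N. min (2 ^ c) (2 ^ b) * card (halted g t c)) + card (full l S t)"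

lemma Dn_Suc: "Dn t p = Suc z \<Longrightarrow> t \<le> t' \<Longrightarrow> Dn t' p = Suc z"
  using Dn_mono[of t p t'] by simp

lemma full_cover_mono: "full_cover l S t v \<Longrightarrow> t \<le> t' \<Longrightarrow> full_cover l S t' v"
  unfolding full_cover_def by (meson Dn_Suc)

lemma small_cover_mono:
  assumes "small_cover g N S t v" "t \<le> t'"
  shows "small_cover g N S t' v"
proof -
  from assms obtain b p r where *: "b < Suc N" "p < 2 ^ g b - 1" "r < 2 ^ S"
    "Dn t p \<noteq> 0" "popcount (Dn t p - 1) \<le> 2 ^ b" "(Dn t p - 1) div 2 ^ (v * 2 ^ S + r - 1) mod 2 = 1"
    unfolding small_cover_def by blast
  moreover have "Dn t' p = Dn t p" using Dn_mono[of t p t'] * assms(2) by simp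
  ultimately show ?thesis unfolding small_cover_def by metis
qed

lemma halted_bounds: "finite (halted g t b)" "card (halted g t b) \<le> 2 ^ g b - 1"
proof -
  have "halted g t b \<subseteq> {..<2 ^ g b - 1}" by (auto simp: halted_def)
  from finite_subset[OF this] card_mono[OF _ this]
  show "finite (halted g t b)" "card (halted g t b) \<le> 2 ^ g b - 1" by auto
qed

text \<open>A full leaf needs one program shorter than \<open>l\<close> for each of its
  \<open>2 ^ S\<close> extensions, and different leaves have different extensions.\<close>

lemma full_bounds: "finite (full l S t)" "card (full l S t) * 2 ^ S \<le> 2 ^ l - 1"
proof -
  let ?O = "(\<lambda>p. Dn t p - 1) ` {..<2 ^ l - 1}"
  let ?f = "\<lambda>(v, r). v * 2 ^ S + r - 1"
  have sub: "?f ` (full l S t \<times> {..<2 ^ S}) \<subseteq> ?O"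
  proof
    fix w assume "w \<in> ?f ` (full l S t \<times> {..<2 ^ S})"
    then obtain v r where w: "w = v * 2 ^ S + r - 1" "full_cover l S t v" "r < 2 ^ S"
      by (auto simp: full_def)
    then obtain p where "p < 2 ^ l - 1" "Dn t p = Suc w"
      unfolding full_cover_def by blast
    then show "w \<in> ?O" by (intro image_eqI[of _ _ p]) auto
  qed
  have inj: "inj_on ?f (full l S t \<times> {..<2 ^ S})"
  proof (rule inj_onI)
    fix x y assume "x \<in> full l S t \<times> {..<2 ^ S}" "y \<in> full l S t \<times> {..<2 ^ S}" "?f x = ?f y"
    moreover obtain v r w s where "x = (v, r)" "y = (w, s)" by fastforce
    ultimately have *: "0 < v" "0 < w" "r < 2 ^ S" "s < 2 ^ S" "v * 2 ^ S + r - 1 = w * 2 ^ S + s - 1"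
      by (auto simp: full_def)
    have "0 < v * 2 ^ S" "0 < w * 2 ^ S" using * by auto
    then have eq: "v * 2 ^ S + r = w * 2 ^ S + s" using *(5) by linarith
    have "v = (v * 2 ^ S + r) div 2 ^ S" using * by simp
    also have "\<dots> = w" unfolding eq using * by simp
    finally show "x = y" using eq \<open>x = (v, r)\<close> \<open>y = (w, s)\<close> by simp
  qed
  have fin: "finite (?f ` (full l S t \<times> {..<2 ^ S}))" using sub by (rule finite_subset) auto
  then have fin': "finite (full l S t \<times> {..<2 ^ S :: nat})" using inj by (rule finite_imageD)
  then show "finite (full l S t)" by (rule finite_cartesian_productD1) (auto simp: lessThan_empty_iff)
  have "card (full l S t) * 2 ^ S = card (full l S t \<times> {..<2 ^ S :: nat})" by (simp add: card_cartesian_product)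
  also have "\<dots> = card (?f ` (full l S t \<times> {..<2 ^ S}))" by (rule card_image[OF inj, symmetric])
  also have "\<dots> \<le> card ?O" by (rule card_mono[OF _ sub]) auto
  also have "\<dots> \<le> card {..<2 ^ l - 1 :: nat}" by (rule card_image_le) auto
  finally show "card (full l S t) * 2 ^ S \<le> 2 ^ l - 1" by simp
qed

lemma covered_0: "\<not> covered g N S l 0 v"
  by (auto simp: covered_def small_cover_def full_cover_def Dn_0 intro!: exI[of _ 0])

text \<open>A newly covered leaf meets the set of a program that has just halted, or has just become
  full. A set counted at level \<open>c\<close> meets at most \<open>2 ^ c\<close> leaves, and there
  are only \<open>2 ^ b\<close> below the node.\<close>

lemma Psi_growth:
  "cover_count (covered g N S l (Suc t)) b v + Psi g N S l b t \<le> cover_count (covered g N S l t) b v + Psi g N S l b (Suc t)"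
proof -
  let ?I = "{v * 2 ^ b..<v * 2 ^ b + 2 ^ b}"
  let ?new = "\<lambda>c. halted g (Suc t) c - halted g t c"
  define Z where "Z c p = {y \<in> ?I. 0 < y \<and> popcount (Dn (Suc t) p - 1) \<le> 2 ^ c \<and>
      (\<exists>r<2 ^ S. (Dn (Suc t) p - 1) div 2 ^ (y * 2 ^ S + r - 1) mod 2 = 1)}" for c p
  let ?F = "full l S (Suc t) - full l S t"
  have "{y \<in> ?I. covered g N S l (Suc t) y} \<subseteq>
      {y \<in> ?I. covered g N S l t y} \<union> (\<Union>c<Suc N. \<Union>p\<in>?new c. Z c p) \<union> ?F" (is "?A \<subseteq> ?B \<union> ?U \<union> ?F")
  proof (intro subsetI, elim CollectE conjE)
    fix y assume y: "y \<in> ?I" "covered g N S l (Suc t) y"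
    show "y \<in> ?B \<union> ?U \<union> ?F"
    proof (cases "covered g N S l t y")
      case False
      from y(2) consider "0 < y" "small_cover g N S (Suc t) y" | "0 < y" "full_cover l S (Suc t) y"
        unfolding covered_def by blast
      then show ?thesis
      proof cases
        case 1
        then obtain c p r where *: "c < Suc N" "p < 2 ^ g c - 1" "r < 2 ^ S" "Dn (Suc t) p \<noteq> 0"
          "popcount (Dn (Suc t) p - 1) \<le> 2 ^ c" "(Dn (Suc t) p - 1) div 2 ^ (y * 2 ^ S + r - 1) mod 2 = 1"
          unfolding small_cover_def by blast
        have "Dn t p = 0"
        proof (rule ccontr)
          assume n: "Dn t p \<noteq> 0"
          then have "Dn (Suc t) p = Dn t p" using Dn_mono[of t p "Suc t"] by simp
          then have "small_cover g N S t y" unfolding small_cover_def using * n by metis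
          with False 1 show False by (simp add: covered_def)
        qed
        with * have "p \<in> ?new c" by (simp add: halted_def)
        moreover have "y \<in> Z c p" using * y(1) 1 by (auto simp: Z_def)
        ultimately show ?thesis using *(1) by blast
      next
        case 2
        with False show ?thesis by (auto simp: covered_def full_def)
      qed
    qed (use y in simp)
  qed
  then have "card ?A \<le> card (?B \<union> ?U \<union> ?F)"
    by (intro card_mono) (auto simp: halted_bounds full_bounds Z_def)
  also have "\<dots> \<le> card ?B + card ?U + card ?F"
    by (meson card_Un_le add_le_mono1 le_trans)
  also have "card ?U \<le> (\<Sum>c<Suc N. min (2 ^ c) (2 ^ b) * card (?new c))"
  proof -
    have Z: "card (Z c p) \<le> min (2 ^ c) (2 ^ b)" for c p
    proof -
      have "card (Z c p) \<le> card ?I" by (rule card_mono) (auto simp: Z_def)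
      moreover have "card (Z c p) \<le> 2 ^ c"
      proof (cases "popcount (Dn (Suc t) p - 1) \<le> 2 ^ c")
        case True
        have "Z c p \<subseteq> (\<lambda>w. (w + 1) div 2 ^ S) ` set_decode (Dn (Suc t) p - 1)"
        proof
          fix y assume "y \<in> Z c p"
          then obtain r where r: "0 < y" "r < 2 ^ S" "(Dn (Suc t) p - 1) div 2 ^ (y * 2 ^ S + r - 1) mod 2 = 1"
            unfolding Z_def by blast
          have "0 < y * 2 ^ S" using r by simp
          then have "(y * 2 ^ S + r - 1 + 1) div 2 ^ S = y" using r by simp
          moreover have "y * 2 ^ S + r - 1 \<in> set_decode (Dn (Suc t) p - 1)"
            using r by (simp add: set_decode_def odd_iff_mod_2_eq_one)
          ultimately show "y \<in> (\<lambda>w. (w + 1) div 2 ^ S) ` set_decode (Dn (Suc t) p - 1)" by force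
        qed
        then have "card (Z c p) \<le> card (set_decode (Dn (Suc t) p - 1))"
          by (meson card_image_le card_mono finite_imageI finite_set_decode le_trans)
        with True show ?thesis by (simp add: popcount_eq_card)
      next
        case False
        then have "Z c p = {}" by (auto simp: Z_def)
        then show ?thesis by simp
      qed
      ultimately show ?thesis by simp
    qed
    have "card ?U \<le> (\<Sum>c<Suc N. card (\<Union>p\<in>?new c. Z c p))" by (rule card_UN_le) simp
    also have "\<dots> \<le> (\<Sum>c<Suc N. \<Sum>p\<in>?new c. card (Z c p))"
      by (intro sum_mono card_UN_le) (simp add: halted_bounds)
    also have "\<dots> \<le> (\<Sum>c<Suc N. \<Sum>p\<in>?new c. min (2 ^ c) (2 ^ b))" by (intro sum_mono Z)
    finally show ?thesis by (simp add: mult.commute)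
  qed
  finally have *: "cover_count (covered g N S l (Suc t)) b v \<le> cover_count (covered g N S l t) b v
      + (\<Sum>c<Suc N. min (2 ^ c) (2 ^ b) * card (?new c)) + card ?F"
    unfolding cover_count_card by simp
  have "card (halted g (Suc t) c) = card (halted g t c) + card (?new c)" for c
  proof -
    have "halted g t c \<subseteq> halted g (Suc t) c" by (auto simp: halted_def Dn_mono[of t _ "Suc t"])
    then show ?thesis by (simp add: card_Diff_subset halted_bounds card_mono)
  qed
  then have "(\<Sum>c<Suc N. min (2 ^ c) (2 ^ b) * card (halted g (Suc t) c)) =
     (\<Sum>c<Suc N. min (2 ^ c) (2 ^ b) * card (halted g t c)) + (\<Sum>c<Suc N. min (2 ^ c) (2 ^ b) * card (?new c))"
    by (simp only: distrib_left sum.distrib)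
  moreover have "card (full l S (Suc t)) = card (full l S t) + card ?F"
  proof -
    have "full l S t \<subseteq> full l S (Suc t)" by (auto simp: full_def intro: full_cover_mono)
    then show ?thesis by (simp add: card_Diff_subset full_bounds card_mono)
  qed
  ultimately show ?thesis using * unfolding Psi_def by linarith
qed

lemma cover_count_le_Psi: "cover_count (covered g N S l t) b v \<le> Psi g N S l b t"
proof (induction t)
  case 0 show ?case by (simp add: cover_count_def covered_0)
next
  case (Suc t) with Psi_growth[of g N S l t b v] show ?case by linarith
qed

lemma Psi_le:
  assumes "\<And>c. c \<le> N \<Longrightarrow> (2 ^ g c - 1) * min (2 ^ c) (2 ^ b) \<le> M" "card (full l S t) \<le> M"
  shows "Psi g N S l b t \<le> (N + 2) * M"
proof -
  have "(\<Sum>c<Suc N. min (2 ^ c) (2 ^ b) * card (halted g t c)) \<le> (\<Sum>c<Suc N. M)"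
  proof (rule sum_mono)
    fix c assume "c \<in> {..<Suc N}"
    have "min (2 ^ c) (2 ^ b) * card (halted g t c) \<le> min (2 ^ c) (2 ^ b) * (2 ^ g c - 1)"
      by (intro mult_le_mono2 halted_bounds)
    also have "\<dots> \<le> M" using assms(1)[of c] \<open>c \<in> {..<Suc N}\<close> by (simp add: mult.commute)
    finally show "min (2 ^ c) (2 ^ b) * card (halted g t c) \<le> M" .
  qed
  with assms(2) show ?thesis unfolding Psi_def by simp
qed

end

text \<open>A step function packed into the base \<open>2 ^ e\<close> digits of one number, so that
  the game can take it as a parameter.\<close>

definition threshold :: "nat \<Rightarrow> nat \<Rightarrow> nat \<Rightarrow> nat \<Rightarrow> nat" where
  "threshold Q e L b = Q div (2 ^ e) ^ (b div L) mod 2 ^ e"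

text \<open>For \<open>2 ^ B \<le> w + 1\<close> this codes the strong model: all strings below the
  same node of height \<open>B\<close> as \<open>w\<close>. It depends on \<open>w\<close> only
  through that node.\<close>

definition cone :: "nat \<Rightarrow> nat \<Rightarrow> nat" where
  "cone B w = (\<Sum>i<2 ^ B. 2 ^ ((w + 1) div 2 ^ B * 2 ^ B + i - 1))"

lemma changes_comp: "changes (\<lambda>t. f (h t)) t \<le> changes h t"
  unfolding changes_def by (intro sum_mono) auto

lemma enc_set_eq: "enc_set A = n2s (set_encode (s2n ` A))"
proof -
  have "inj_on s2n A" by (rule inj_on_inverseI[of _ n2s]) simp
  then show ?thesis unfolding enc_set_def set_encode_def by (simp add: sum.reindex)
qed

lemma cone_enc:
  assumes "2 ^ B \<le> w + 1"
  obtains A where "finite A" "n2s w \<in> A" "card A = 2 ^ B" "enc_set A = n2s (cone B w)"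
proof -
  define V where "V = (w + 1) div 2 ^ B"
  let ?f = "\<lambda>i. V * 2 ^ B + i - 1"
  have "(2 ^ B) div 2 ^ B \<le> V" unfolding V_def using assms by (rule div_le_mono)
  then have V: "1 \<le> V * 2 ^ B" by simp
  have inj: "inj_on ?f {..<2 ^ B}" using V by (intro inj_onI) linarith
  have w: "w = ?f ((w + 1) mod 2 ^ B)"
    unfolding V_def by (metis add_diff_cancel_right' div_mult_mod_eq)
  have injn: "inj_on n2s X" for X by (rule inj_onI) (simp add: n2s_inject)
  show thesis
  proof (rule that[of "n2s ` ?f ` {..<2 ^ B}"])
    show "n2s w \<in> n2s ` ?f ` {..<2 ^ B}" using w by (intro imageI) (auto intro!: image_eqI[of _ _ "(w + 1) mod 2 ^ B"])
    show "card (n2s ` ?f ` {..<2 ^ B}) = 2 ^ B"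
      by (subst card_image[OF injn], subst card_image[OF inj], simp)
    show "enc_set (n2s ` ?f ` {..<2 ^ B}) = n2s (cone B w)"
      unfolding enc_set_eq set_encode_def cone_def V_def[symmetric]
      by (simp only: image_image s2n_n2s sum.reindex[OF inj] o_def)
  qed auto
qed

section \<open>Complexity of nodes, cones and uncovered leaves\<close>

context kolmogorov
begin

text \<open>A node is represented by the first string below it, so that it can be fed to
  \<open>cone\<close>. The term \<open>2 * blen Q\<close> is the price of the sampled
  boundary.\<close>

lemma K_node:
  obtains c where "\<And>t Q e L N S l b. K (run (covered (threshold Q e L) N S l) N t div 2 ^ b * 2 ^ (b + S) - 1)
    \<le> blen (changes (\<lambda>t. run (covered (threshold Q e L) N S l) N t div 2 ^ b) t)
      + 2 * (blen Q + blen e + blen L + blen N + blen S + blen l + blen b) + c"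
proof -
  define h where "h t xs = run (covered (threshold (hd xs) (hd (tl xs)) (hd (tl (tl xs)))) (hd (tl (tl (tl xs))))
    (hd (tl (tl (tl (tl xs))))) (hd (tl (tl (tl (tl (tl xs))))))) (hd (tl (tl (tl xs)))) t
    div 2 ^ hd (tl (tl (tl (tl (tl (tl xs))))))
    * 2 ^ (hd (tl (tl (tl (tl (tl (tl xs)))))) + hd (tl (tl (tl (tl xs))))) - 1" for t xs
  have "total_comp (Suc 7) (\<lambda>xs. h (hd xs) (tl xs))"
    unfolding h_def run_def game_step_def violated_def fresh_def cover_count_def covered_def small_cover_def full_cover_def threshold_def
    by (intro total_comp_rec total_comp_intros total_comp_popcount total_comp_comp2[OF total_comp_Dn] total_comp_vars) simp_all
  then show thesis
  proof (rule K_changes[of 7 h])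
    fix c assume c: "length as = 7 \<Longrightarrow>
      K (h t as) \<le> blen (changes (\<lambda>t. h t as) t) + 2 * (\<Sum>a\<leftarrow>as. blen a) + c" for as t
    show thesis
    proof (rule that[of c])
      fix t Q e L N S l b :: nat
      let ?as = "[Q, e, L, N, S, l, b]"
      let ?X = "run (covered (threshold Q e L) N S l) N"
      have h: "h t ?as = ?X t div 2 ^ b * 2 ^ (b + S) - 1" for t by (simp add: h_def)
      have "changes (\<lambda>t. h t ?as) t \<le> changes (\<lambda>t. ?X t div 2 ^ b) t"
        unfolding h using changes_comp[of "\<lambda>v. v * 2 ^ (b + S) - 1" "\<lambda>t. ?X t div 2 ^ b" t] .
      then have "blen (changes (\<lambda>t. h t ?as) t) \<le> blen (changes (\<lambda>t. ?X t div 2 ^ b) t)"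
        using length_n2s[of "changes (\<lambda>t. ?X t div 2 ^ b) t"] unfolding length_n2s_le by linarith
      then show "K (?X t div 2 ^ b * 2 ^ (b + S) - 1) \<le> blen (changes (\<lambda>t. ?X t div 2 ^ b) t)
          + 2 * (blen Q + blen e + blen L + blen N + blen S + blen l + blen b) + c"
        using c[of ?as t] unfolding h by simp
    qed
  qed
qed

lemma total_comp_cone: "total_comp (Suc 1) (\<lambda>xs. cone (hd (tl xs)) (hd xs))"
  unfolding cone_def by (intro total_comp_intros total_comp_vars) simp_all

lemma K_cone: obtains c where "\<And>B w. K (cone B w) \<le> K w + 2 * blen B + c"
proof (rule K_image[of 1 "\<lambda>w as. cone (hd as) w", OF total_comp_cone])
  fix c assume "length as = 1 \<Longrightarrow> K (cone (hd as) m) \<le> K m + 2 * (\<Sum>a\<leftarrow>as. blen a) + c" for as m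
  from this[of "[_]"] show thesis by (intro that[of c]) simp
qed

lemma CT_cone: obtains c where "\<And>B w. CT D (n2s (cone B w)) (n2s w) \<le> 2 * blen B + c"
proof (rule CT_image[of 1 "\<lambda>w as. cone (hd as) w", OF total_comp_cone])
  fix c assume "length as = 1 \<Longrightarrow> CT D (n2s (cone (hd as) m)) (n2s m) \<le> 2 * (\<Sum>a\<leftarrow>as. blen a) + c" for as m
  from this[of "[_]"] show thesis by (intro that[of c]) simp
qed

lemma K_Suc: obtains c where "\<And>w. K (Suc w) \<le> K w + c"
proof (rule K_image[of 0 "\<lambda>w as. Suc w"])
  show "total_comp (Suc 0) (\<lambda>xs. Suc (hd xs))" by (intro total_comp_intros total_comp_vars) simp
  fix c assume "length as = 0 \<Longrightarrow> K (Suc m) \<le> K m + 2 * (\<Sum>a\<leftarrow>as. blen a) + c" for as m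
  from this[of "[]"] show thesis by (intro that[of c]) simp
qed

lemma short_program:
  assumes "K z < l"
  obtains p t where "p < 2 ^ l - 1" "\<And>t'. t \<le> t' \<Longrightarrow> Dn t' p = Suc z"
proof -
  obtain p t where p: "blen p = K z" "Dn t p = Suc z" by (rule K_program)
  have "p + 1 < 2 ^ Suc (K z)" using length_n2s[of p] p(1) by simp
  also have "\<dots> \<le> 2 ^ l" using assms by (intro power_increasing) auto
  finally have "p < 2 ^ l - 1" by linarith
  with p(2) Dn_Suc that show thesis by blast
qed

text \<open>The hypotheses are for \<open>root\<close>: the \<open>N + 1\<close> levels and the full
  leaves contribute at most \<open>M\<close> covered leaves each, and \<open>root\<close> itself
  brings the second factor \<open>N + 2\<close>.\<close>

lemma game_covered:
  assumes "M * (N + 2)\<^sup>2 \<le> 2 ^ N" "\<And>c. c \<le> N \<Longrightarrow> (2 ^ g c - 1) * 2 ^ c \<le> M" "\<And>t. card (full l S t) \<le> M"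
  shows "game N (covered g N S l) (Psi g N S l)"
proof
  show "covered g N S l t' v" if "covered g N S l t v" "t \<le> t'" for t t' v
    using that small_cover_mono full_cover_mono unfolding covered_def by blast
  show "cover_count (covered g N S l 0) b v \<le> Psi g N S l b 0" for b v by (rule cover_count_le_Psi)
  show "cover_count (covered g N S l (Suc t)) b v + Psi g N S l b t \<le> cover_count (covered g N S l t) b v + Psi g N S l b (Suc t)" for t b v
    by (rule Psi_growth)
  show "(N + 2) * cover_count (covered g N S l t) N 1 \<le> 2 ^ N" for t
  proof -
    have "(2 ^ g c - 1) * min (2 ^ c) (2 ^ N) \<le> M" if "c \<le> N" for c
    proof -
      have "(2 ^ g c - 1) * min (2 ^ c) (2 ^ N) \<le> (2 ^ g c - 1) * (2 ^ c :: nat)" by (intro mult_le_mono2) simp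
      with assms(2)[OF that] show ?thesis by linarith
    qed
    then have "Psi g N S l N t \<le> (N + 2) * M" using assms(3) by (intro Psi_le)
    then have "(N + 2) * cover_count (covered g N S l t) N 1 \<le> (N + 2) * ((N + 2) * M)"
      using cover_count_le_Psi[of g N S l t N 1] by (intro mult_le_mono2) linarith
    also have "\<dots> = M * (N + 2)\<^sup>2" by (simp add: power2_eq_square algebra_simps)
    finally show ?thesis using assms(1) by linarith
  qed
qed

text \<open>From height \<open>b\<close> up to \<open>d\<close> the share of a set grows at most by
  \<open>2 ^ (d - b)\<close>, just as the number of leaves below a node does. So the bound at
  \<open>b\<close> carries over to all greater heights.\<close>

lemma changes_run_covered_le:
  assumes "game N (covered g N S l) (Psi g N S l)" "b \<le> N"
    and W: "\<And>c. c \<le> N \<Longrightarrow> (2 ^ g c - 1) * min (2 ^ c) (2 ^ b) \<le> (2 :: nat) ^ (W + b)"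
    and full: "card (full l S t) \<le> 2 ^ (W + b)"
  shows "changes (\<lambda>t. run (covered g N S l) N t div 2 ^ b) t \<le> (N + 1) * ((N + 2) * ((N + 2) * 2 ^ W))"
proof (rule game.changes_run_le[OF assms(1,2)])
  fix d assume d: "b \<le> d" "d \<le> N"
  have pow: "(2::nat) ^ (W + d) = 2 ^ (W + b) * 2 ^ (d - b)"
    using d by (simp add: power_add[symmetric])
  have "Psi g N S l d t \<le> (N + 2) * 2 ^ (W + d)"
  proof (rule Psi_le)
    fix c assume "c \<le> N"
    have "min (2 ^ c) (2 ^ d) \<le> min (2 ^ c) (2 ^ b) * (2 ^ (d - b) :: nat)"
    proof (cases "c \<le> b")
      case True
      then have "min (2 ^ c) (2 ^ b) = (2 ^ c :: nat)" by (simp add: power_increasing)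
      moreover have "min (2 ^ c) (2 ^ d) \<le> (2 ^ c :: nat)" "(2 ^ c :: nat) \<le> 2 ^ c * 2 ^ (d - b)" by simp_all
      ultimately show ?thesis by (metis le_trans)
    next
      case False
      then have "min (2 ^ c) (2 ^ b) = (2 ^ b :: nat)" by (simp add: power_increasing)
      then show ?thesis using d by (simp add: power_add[symmetric])
    qed
    then have "(2 ^ g c - 1) * min (2 ^ c) (2 ^ d) \<le> (2 ^ g c - 1) * (min (2 ^ c) (2 ^ b) * 2 ^ (d - b) :: nat)"
      by (rule mult_le_mono2)
    also have "\<dots> \<le> 2 ^ (W + d)"
      unfolding pow mult.assoc[symmetric] using W[OF \<open>c \<le> N\<close>] by (rule mult_le_mono1)
    finally show "(2 ^ g c - 1) * min (2 ^ c) (2 ^ d) \<le> (2 :: nat) ^ (W + d)" .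
  next
    have "(2::nat) ^ (W + b) \<le> 2 ^ (W + d)" using d by (intro power_increasing) auto
    with full show "card (full l S t) \<le> 2 ^ (W + d)" by linarith
  qed
  then show "Psi g N S l d t \<le> (N + 2) * 2 ^ W * 2 ^ d" by (simp add: power_add algebra_simps)
qed

lemma uncovered_leaf:
  assumes "game N (covered g N S l) (Psi g N S l)" "\<And>t. card (full l S t) \<le> M" "\<And>c. c \<le> N \<Longrightarrow> (2 ^ g c - 1) * 2 ^ c \<le> M"
  obtains T where "\<And>t. \<not> covered g N S l t (run (covered g N S l) N T)"
proof -
  have "Psi g N S l c t \<le> (N + 2) * M * 2 ^ c" if "c \<le> N" for c t
  proof -
    have "(2 ^ g d - 1) * min (2 ^ d) (2 ^ c) \<le> M" if "d \<le> N" for d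
    proof -
      have "(2 ^ g d - 1) * min (2 ^ d) (2 ^ c) \<le> (2 ^ g d - 1) * (2 ^ d :: nat)" by (intro mult_le_mono2) simp
      with assms(3)[OF that] show ?thesis by linarith
    qed
    then have "Psi g N S l c t \<le> (N + 2) * M" using assms(2) by (intro Psi_le)
    then show ?thesis by (simp add: trans_le_add1 le_trans)
  qed
  from game.run_limit[OF assms(1) this] that show thesis by blast
qed

text \<open>Otherwise all extensions have programs shorter than \<open>l\<close>, and at a stage
  when all of these have halted, here the sum of the single stages, the leaf is full.\<close>

lemma uncovered_extension:
  assumes "\<And>t. \<not> covered g N S l t v" "0 < v"
  shows "\<exists>r<2 ^ S. l \<le> K (v * 2 ^ S + r - 1)"
proof (rule ccontr)
  assume "\<not> ?thesis"
  then have "\<forall>r<2 ^ S. \<exists>p t. p < 2 ^ l - 1 \<and> (\<forall>t'\<ge>t. Dn t' p = Suc (v * 2 ^ S + r - 1))"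
    using short_program by (metis not_le)
  then obtain p t where pt: "\<And>r. r < 2 ^ S \<Longrightarrow> p r < 2 ^ l - 1"
      "\<And>r t'. r < 2 ^ S \<Longrightarrow> t r \<le> t' \<Longrightarrow> Dn t' (p r) = Suc (v * 2 ^ S + r - 1)" by metis
  have "t r \<le> (\<Sum>r<2 ^ S. t r)" if "r < 2 ^ S" for r
    using that by (intro member_le_sum) auto
  with pt have "full_cover l S (\<Sum>r<2 ^ S. t r) v" unfolding full_cover_def by metis
  with assms show False unfolding covered_def by blast
qed

text \<open>A simpler \<open>A\<close> would be enumerated at some stage and, containing
  \<open>n2s w\<close>, would cover the leaf above \<open>w\<close>.\<close>

lemma uncovered_K:
  assumes "\<And>t. \<not> covered g N S l t v" "0 < v" "(w + 1) div 2 ^ S = v"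
    and "finite A" "n2s w \<in> A" "card A \<le> 2 ^ b" "b \<le> N"
  shows "g b \<le> KC D (enc_set A) []"
proof (rule ccontr)
  assume "\<not> ?thesis"
  then have "K (set_encode (s2n ` A)) < g b" by (simp add: enc_set_eq)
  then obtain p t where p: "p < 2 ^ g b - 1" "Dn t p = Suc (set_encode (s2n ` A))"
    using short_program by (metis order_refl)
  have dec: "set_decode (set_encode (s2n ` A)) = s2n ` A"
    using assms by (intro set_encode_inverse) auto
  have "card (s2n ` A) \<le> card A" using assms by (intro card_image_le)
  then have "popcount (set_encode (s2n ` A)) \<le> 2 ^ b" unfolding popcount_eq_card dec using assms by linarith
  moreover have "w \<in> set_decode (set_encode (s2n ` A))" unfolding dec using assms(5) by force
  moreover have "v * 2 ^ S + (w + 1) mod 2 ^ S - 1 = w"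
    unfolding assms(3)[symmetric] by (metis add_diff_cancel_right' div_mult_mod_eq)
  moreover have "(w + 1) mod 2 ^ S < 2 ^ S" by simp
  ultimately have "small_cover g N S t v"
    unfolding small_cover_def using p assms(7)
    by (metis diff_Suc_1 le_imp_less_Suc nat.distinct(1) odd_iff_mod_2_eq_one mem_Collect_eq set_decode_def)
  with assms(1,2) show False unfolding covered_def by blast
qed

end

section \<open>Choice of the parameters\<close>

lemma digits_less:
  assumes "\<And>j. j < J \<Longrightarrow> q j < (B::nat)"
  shows "(\<Sum>j<J. q j * B ^ j) < B ^ J"
  using assms
proof (induction J)
  case (Suc J)
  have "(\<Sum>j<J. q j * B ^ j) < B ^ J" using Suc by simp
  moreover have "Suc (q J) * B ^ J \<le> B * B ^ J" using Suc.prems[of J] by (intro mult_le_mono1) simp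
  ultimately show ?case by simp
qed simp

lemma digits_nth:
  assumes "\<And>j. j < J \<Longrightarrow> q j < (B::nat)" "i < J"
  shows "(\<Sum>j<J. q j * B ^ j) div B ^ i mod B = q i"
  using assms
proof (induction J)
  case (Suc J)
  have B: "0 < B" using Suc.prems(1)[of J] by simp
  show ?case
  proof (cases "i = J")
    case True
    have "(\<Sum>j<J. q j * B ^ j) < B ^ J" by (rule digits_less) (use Suc.prems in simp)
    then show ?thesis using True B Suc.prems(1)[of J] by simp
  next
    case False
    then have "i < J" using Suc.prems by simp
    then have "B ^ J = B ^ i * (B * B ^ (J - Suc i))"
      by (simp only: power_Suc[symmetric] power_add[symmetric]) simp
    then have eq: "(\<Sum>j<Suc J. q j * B ^ j) = (\<Sum>j<J. q j * B ^ j) + B ^ i * (B * (q J * B ^ (J - Suc i)))"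
      by (simp add: algebra_simps)
    have "(\<Sum>j<Suc J. q j * B ^ j) div B ^ i = (\<Sum>j<J. q j * B ^ j) div B ^ i + B * (q J * B ^ (J - Suc i))"
      unfolding eq using B by simp
    then show ?thesis using Suc \<open>i < J\<close> by simp
  qed
qed simp

text \<open>\<open>f\<close> is the boundary of \<open>P\<close>, sampled at multiples of \<open>L\<close> (about the square root of \<open>n log n\<close>), so that
  all samples together fit into a number \<open>Q\<close> of about \<open>L\<close> bits. Lowering the boundary by \<open>2 L\<close>
  in \<open>q\<close> pays for the description of \<open>Q\<close>; the last \<open>S\<close> bits of the string are kept free to correct
  its complexity afterwards.\<close>

locale profile_params =
  fixes n k e L :: nat and f :: "nat \<Rightarrow> nat"
  assumes n: "2 \<le> n" and e: "e = Suc (blen n)" and L: "n * e \<le> L * L" "e \<le> L" "L \<le> n"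
    and k: "k \<le> n"
    and f_le: "f b \<le> k" and f_anti: "b \<le> b' \<Longrightarrow> f b' \<le> f b" and f_slope: "f b \<le> f (b + d) + d"
    and f_ge: "k \<le> f b + b" and f_n: "f n = 0"
begin

definition S :: nat where "S = min n (2 * L)"

definition N :: nat where "N = n - S"

text \<open>If there are full leaves at all, there are at most \<open>2 ^ (l - S)\<close>, hence at
  most \<open>2 ^ (N - 3 * e)\<close>. The missing factor \<open>2 ^ (3 * e)\<close> leaves room for
  the \<open>(N + 2)^2\<close> of the root condition.\<close>

definition l :: nat where "l = k - 3 * e"

text \<open>The first term pays for \<open>Q\<close> at the leaf, the third is the sample. The
  second keeps \<open>g b + b\<close> below \<open>N - 3 * L\<close> wherever \<open>g b\<close> is
  positive, so that a level covers at most \<open>M\<close> leaves; \<open>Suc j\<close> reaches to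
  the end of block \<open>j\<close>.\<close>

definition q :: "nat \<Rightarrow> nat" where
  "q j = min (min (k - 2 * L) (N - (Suc j * L + 3 * L))) (f (j * L))"

definition Q :: nat where "Q = (\<Sum>j<Suc (n div L). q j * (2 ^ e) ^ j)"

abbreviation "g \<equiv> threshold Q e L"

text \<open>For \<open>N < 3 * e\<close> the bound 0 is correct: all thresholds vanish, no leaf is
  full, nothing is ever covered.\<close>

definition M :: nat where "M = (if 3 * e \<le> N then 2 ^ (N - 3 * e) else 0)"

lemma e_pos: "2 \<le> e" and n_less: "n < 2 ^ e"
proof -
  show "n < 2 ^ e" using less_power_blen[of n] e by simp
  show "2 \<le> e"
  proof (rule ccontr)
    assume "\<not> 2 \<le> e"
    then have "(2::nat) ^ e \<le> 2 ^ 1" by (intro power_increasing) auto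
    with \<open>n < 2 ^ e\<close> n show False by simp
  qed
qed

lemma L_pos: "0 < L" using e_pos L by linarith

lemma S_N: "N + S = n" "S \<le> n" "S \<le> 2 * L"
  by (auto simp: S_def N_def)

lemma blen_le: "y \<le> 2 * n \<Longrightarrow> blen y \<le> e"
  using n_less by (simp add: length_n2s_le)

lemma f_le_diff: "b \<le> n \<Longrightarrow> f b \<le> n - b"
  using f_slope[of b "n - b"] f_n by simp

lemma f_slope': "b \<le> b' \<Longrightarrow> f b \<le> f b' + (b' - b)"
  using f_slope[of b "b' - b"] by simp

lemma q_less: "q j < 2 ^ e"
proof -
  have "q j \<le> k" unfolding q_def by simp
  with k n_less show ?thesis by linarith
qed

lemma g_eq: "b \<le> n \<Longrightarrow> g b = q (b div L)"
  unfolding threshold_def Q_def by (rule digits_nth) (auto simp: q_less le_imp_less_Suc div_le_mono)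

lemma div_L: "b div L * L \<le> b" "b < b div L * L + L"
  using dividend_less_div_times[OF L_pos, of b] by (simp_all add: div_times_less_eq_dividend add.commute)

text \<open>This fixes \<open>L\<close>: about \<open>n / L\<close> samples of \<open>e\<close> bits
  balance the rounding error \<open>L\<close> when \<open>L * L\<close> is about
  \<open>n * e\<close>.\<close>

lemma blen_Q: "blen Q \<le> L + e"
proof -
  have "Q < (2 ^ e) ^ Suc (n div L)" unfolding Q_def by (rule digits_less) (rule q_less)
  also have "\<dots> = 2 ^ (e * Suc (n div L))" by (rule power_mult[symmetric])
  finally have "Q + 1 < 2 ^ Suc (e * Suc (n div L))" by simp
  then have "blen Q \<le> e * Suc (n div L)" by (simp only: length_n2s_le)
  moreover have "e * (n div L) \<le> L"
  proof -
    have "e * (n div L) * L \<le> e * n" using div_L(1)[of n] by (simp add: mult.assoc)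
    also have "\<dots> \<le> L * L" using L(1) by (simp add: mult.commute)
    finally show ?thesis using L_pos by simp
  qed
  ultimately show ?thesis by simp
qed

text \<open>When \<open>k - 2 * L\<close> is truncated it cannot pay for \<open>Q\<close>, but then
  all samples are 0 and \<open>Q\<close> costs nothing.\<close>

lemma Q_eq_0: "k < 2 * L \<Longrightarrow> Q = 0"
  by (simp add: Q_def q_def)

lemma N_2: "(N + 2)\<^sup>2 \<le> 2 ^ (3 * e)"
proof -
  have "N + 2 \<le> 2 * n" using S_N n by linarith
  also have "\<dots> \<le> 2 ^ Suc e" using n_less by simp
  finally have "(N + 2)\<^sup>2 \<le> (2 ^ Suc e)\<^sup>2" by (rule power_mono) simp
  also have "\<dots> = 2 ^ (2 * Suc e)" by (simp only: power_mult[symmetric] mult.commute)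
  also have "\<dots> \<le> 2 ^ (3 * e)" using e_pos by (intro power_increasing) auto
  finally show ?thesis .
qed

lemma M_le: "M * (N + 2)\<^sup>2 \<le> 2 ^ N"
proof (cases "3 * e \<le> N")
  case True
  have "2 ^ (N - 3 * e) * (N + 2)\<^sup>2 \<le> 2 ^ (N - 3 * e) * 2 ^ (3 * e)" using N_2 by (rule mult_le_mono2)
  also have "\<dots> = 2 ^ N" using True by (simp add: power_add[symmetric])
  finally show ?thesis using True by (simp add: M_def)
qed (simp add: M_def)

lemma g_le_M: assumes "b \<le> N" shows "(2 ^ g b - 1) * 2 ^ b \<le> M"
proof (cases "g b = 0")
  case False
  have g: "g b = q (b div L)" using assms S_N by (intro g_eq) simp
  with False have "Suc (b div L) * L + 3 * L < N" "q (b div L) \<le> N - (Suc (b div L) * L + 3 * L)"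
    by (auto simp: q_def)
  then have *: "g b + b \<le> N - 3 * L" "3 * L < N" using div_L(2)[of b] g by simp_all
  have "(2 ^ g b - 1) * 2 ^ b \<le> (2 ^ g b * 2 ^ b :: nat)" by (intro mult_le_mono1) simp
  also have "\<dots> = 2 ^ (g b + b)" by (simp add: power_add)
  also have "\<dots> \<le> 2 ^ (N - 3 * e)" using * L(2) by (intro power_increasing) auto
  finally show ?thesis using * L(2) by (simp add: M_def)
qed simp

lemma card_full_cases:
  assumes "c * 2 ^ S \<le> (2 ^ l - 1 :: nat)"
  obtains "c = 0" | "S \<le> l" "0 < l" "c \<le> 2 ^ (l - S)"
proof (cases "c = 0")
  case False
  have *: "c * 2 ^ S < 2 ^ l" using assms by (metis Suc_diff_1 le_imp_less_Suc pos2 zero_less_power)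
  then have "2 ^ S < (2 ^ l :: nat)" using False by (metis One_nat_def Suc_leI le_less_trans mult_1 mult_le_mono1 not_gr_zero)
  then have "S < l" by simp
  moreover have "c \<le> 2 ^ (l - S)"
  proof -
    have "c * 2 ^ S < 2 ^ (l - S) * 2 ^ S" using * \<open>S < l\<close> by (simp add: power_add[symmetric])
    then show ?thesis by simp
  qed
  ultimately show ?thesis using that by simp
qed (use that in simp)

lemma full_le_M: assumes "c * 2 ^ S \<le> (2 ^ l - 1 :: nat)" shows "c \<le> M"
  using assms
proof (cases rule: card_full_cases)
  case 2
  then have "3 * e \<le> N" "l - S \<le> N - 3 * e" using k S_N by (auto simp: l_def)
  moreover from this have "(2::nat) ^ (l - S) \<le> 2 ^ (N - 3 * e)" by (intro power_increasing) auto
  ultimately have "3 * e \<le> N" "c \<le> 2 ^ (N - 3 * e)" using 2(3) by linarith+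
  then show ?thesis unfolding M_def by (simp only: if_True)
qed simp

lemma leaf_weight:
  "c \<le> N \<Longrightarrow> (2 ^ g c - 1) * min (2 ^ c) (2 ^ 0) \<le> (2 :: nat) ^ (k - 2 * L + 0)"
proof -
  assume "c \<le> N"
  then have "g c \<le> k - 2 * L" using g_eq[of c] S_N by (simp add: q_def)
  then have "(2::nat) ^ g c \<le> 2 ^ (k - 2 * L)" by (intro power_increasing) auto
  then have "(2::nat) ^ g c - 1 \<le> 2 ^ (k - 2 * L)" by linarith
  moreover have "min (2 ^ c) (2 ^ 0) = (1 :: nat)" by simp
  ultimately show ?thesis by (simp only: mult_1_right add_0_right)
qed

lemma leaf_full: assumes "c * 2 ^ S \<le> (2 ^ l - 1 :: nat)" shows "c \<le> 2 ^ (k - 2 * L + 0)"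
  using assms
proof (cases rule: card_full_cases)
  case 2
  have "l - S \<le> k - 2 * L"
  proof (cases "2 * L \<le> n")
    case True then show ?thesis by (simp add: S_def l_def)
  next
    case False
    then have "l = 0" using 2 k e_pos by (simp add: S_def l_def)
    then show ?thesis by simp
  qed
  then have "(2::nat) ^ (l - S) \<le> 2 ^ (k - 2 * L)" by (intro power_increasing) auto
  with 2(3) show ?thesis unfolding add_0_right by (rule le_trans)
qed simp

text \<open>Compare exponents: \<open>f\<close> falls by at most 1 per step, so a sample taken below
  \<open>b\<close> exceeds \<open>f b\<close> by at most the distance, which the smaller size of the
  sets makes up for; rounding to sample points costs at most \<open>L\<close>.\<close>

lemma node_weight:
  assumes "b \<le> N" "c \<le> N"
  shows "(2 ^ g c - 1) * min (2 ^ c) (2 ^ b) \<le> (2 :: nat) ^ (f b + L + b)"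
proof -
  let ?c = "c div L * L"
  have gf: "g c \<le> f ?c" using g_eq[of c] assms S_N by (simp add: q_def)
  have "g c + min c b \<le> f b + L + b"
  proof (cases "c \<le> b")
    case True
    then have "f ?c \<le> f b + (b - ?c)" using div_L(1)[of c] by (intro f_slope') linarith
    then show ?thesis using gf True div_L[of c] by linarith
  next
    case False
    show ?thesis
    proof (cases "b \<le> ?c")
      case True
      then have "f ?c \<le> f b" by (rule f_anti)
      then show ?thesis using gf False by simp
    next
      case f: False
      then have "f ?c \<le> f b + (b - ?c)" by (intro f_slope') simp
      then show ?thesis using gf False f div_L[of c] by simp
    qed
  qed
  then have "(2::nat) ^ (g c + min c b) \<le> 2 ^ (f b + L + b)" by (intro power_increasing) auto
  moreover have "min (2 ^ c) (2 ^ b) = (2 ^ min c b :: nat)" by (simp add: min_def)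
  then have "(2 ^ g c - 1) * min (2 ^ c) (2 ^ b) \<le> (2 ^ (g c + min c b) :: nat)"
    by (simp add: power_add)
  ultimately show ?thesis by linarith
qed

text \<open>The full leaves number at most \<open>2 ^ k\<close>, and \<open>f_ge\<close> says that
  the boundary lies above the line a + b = k.\<close>

lemma node_full: assumes "c * 2 ^ S \<le> (2 ^ l - 1 :: nat)" shows "c \<le> 2 ^ (f b + L + b)"
  using assms
proof (cases rule: card_full_cases)
  case 2
  have "l - S \<le> f b + L + b" using f_ge[of b] by (simp add: l_def)
  then have "(2::nat) ^ (l - S) \<le> 2 ^ (f b + L + b)" by (intro power_increasing) auto
  with 2(3) show ?thesis unfolding add_0_right by (rule le_trans)
qed simp

text \<open>The worst loss is in the second term of \<open>q\<close>: up to \<open>4 * L\<close>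
  from block and margin, and \<open>S \<le> 2 * L\<close> from \<open>N\<close> in place of
  \<open>n\<close>.\<close>

lemma f_le_g: assumes "b \<le> N" shows "f b \<le> g b + 6 * L"
proof -
  have "f b \<le> k - 2 * L + 6 * L" using f_le[of b] by simp
  moreover have "f b \<le> N - (Suc (b div L) * L + 3 * L) + 6 * L"
  proof -
    have "Suc (b div L) * L + 3 * L = b div L * L + 4 * L" by simp
    then show ?thesis using f_le_diff[of b] assms S_N div_L(1)[of b] by linarith
  qed
  moreover have "f b \<le> f (b div L * L) + 6 * L" using f_anti[OF div_L(1), of b] by simp
  moreover have "g b = q (b div L)" using assms S_N by (intro g_eq) simp
  ultimately show ?thesis unfolding q_def by (simp only: min_add_distrib_left min_add_distrib_right min.bounded_iff)
qed

lemma f_min_N: "f (min b N) \<le> f b + 2 * L"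
proof (cases "b \<le> N")
  case False
  show ?thesis
  proof (cases "b \<le> n")
    case True
    with False f_slope'[of N b] S_N show ?thesis by simp
  next
    case False
    with f_le_diff[of N] S_N show ?thesis by simp
  qed
qed simp

end

section \<open>Construction of the string\<close>

context kolmogorov
begin

text \<open>Three factors of at most \<open>2 ^ Suc e\<close> in the number of changes give
  \<open>3 * e + 3\<close>; six parameters besides \<open>Q\<close>, of length at most
  \<open>e\<close> and charged twice, give \<open>12 * e\<close>.\<close>

lemma K_run:
  assumes c: "\<And>t Q e L N S l b. K (run (covered (threshold Q e L) N S l) N t div 2 ^ b * 2 ^ (b + S) - 1)
    \<le> blen (changes (\<lambda>t. run (covered (threshold Q e L) N S l) N t div 2 ^ b) t)
      + 2 * (blen Q + blen e + blen L + blen N + blen S + blen l + blen b) + c"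
    and "profile_params n k e L f"
    and defs: "Q = profile_params.Q n k e L f" "N = profile_params.N n L" "S = profile_params.S n L"
      "l = profile_params.l k e"
    and b: "b \<le> N"
    and W: "\<And>c. c \<le> N \<Longrightarrow> (2 ^ threshold Q e L c - 1) * min (2 ^ c) (2 ^ b) \<le> (2 :: nat) ^ (W + b)"
    and full: "card (full l S t) \<le> 2 ^ (W + b)"
  shows "K (run (covered (threshold Q e L) N S l) N t div 2 ^ b * 2 ^ (b + S) - 1) \<le> W + 2 * blen Q + 15 * e + 3 + c"
proof -
  interpret p: profile_params n k e L f by fact
  let ?X = "run (covered (threshold Q e L) N S l) N"
  have game: "game N (covered (threshold Q e L) N S l) (Psi (threshold Q e L) N S l)"
    unfolding defs by (rule game_covered[OF p.M_le p.g_le_M p.full_le_M[OF full_bounds(2)]])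
  have "changes (\<lambda>t. ?X t div 2 ^ b) t \<le> (N + 1) * ((N + 2) * ((N + 2) * 2 ^ W))"
    by (rule changes_run_covered_le[OF game b W full])
  also have "\<dots> \<le> 2 ^ Suc e * (2 ^ Suc e * (2 ^ Suc e * 2 ^ W))"
  proof -
    have "N + 2 \<le> 2 * n" using p.S_N p.n defs by linarith
    then have "N + 2 \<le> 2 ^ Suc e" using p.n_less by simp
    then show ?thesis by (intro mult_mono) auto
  qed
  also have "\<dots> = 2 ^ (W + 3 * e + 3)"
    unfolding power_add[symmetric] by (rule arg_cong[of _ _ "(^) 2"]) simp
  finally have "changes (\<lambda>t. ?X t div 2 ^ b) t + 1 < 2 ^ Suc (W + 3 * e + 3)"
    using one_less_power[of "2::nat" "W + 3 * e + 3"] unfolding power_Suc by linarith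
  then have ch: "blen (changes (\<lambda>t. ?X t div 2 ^ b) t) \<le> W + 3 * e + 3"
    unfolding length_n2s_le .
  have small: "blen e \<le> e" "blen L \<le> e" "blen N \<le> e" "blen S \<le> e" "blen l \<le> e" "blen b \<le> e"
    using p.L p.S_N p.k b unfolding defs p.l_def by (auto intro!: p.blen_le)
  have arith: "x \<le> W + 3 * e + 3 \<Longrightarrow> a1 \<le> e \<Longrightarrow> a2 \<le> e \<Longrightarrow> a3 \<le> e \<Longrightarrow> a4 \<le> e \<Longrightarrow> a5 \<le> e \<Longrightarrow> a6 \<le> e \<Longrightarrow>
      x + 2 * (z + a1 + a2 + a3 + a4 + a5 + a6) + c \<le> W + 2 * z + 15 * e + 3 + c"
    for x a1 a2 a3 a4 a5 a6 z :: nat by simp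
  show ?thesis by (rule le_trans[OF c[of Q e L N S l t b] arith[OF ch small]])
qed

lemma ex_string:
  obtains C where "\<And>n k e L f. profile_params n k e L f \<Longrightarrow> \<exists>w. 2 ^ n \<le> w + 1 \<and> w + 1 < 2 ^ Suc n
    \<and> k \<le> K w + C * e \<and> K w \<le> k + C * e
    \<and> (\<forall>A b. finite A \<longrightarrow> n2s w \<in> A \<longrightarrow> card A \<le> 2 ^ b \<longrightarrow> f b \<le> KC D (enc_set A) [] + C * L)
    \<and> (\<forall>b. \<exists>A. finite A \<and> n2s w \<in> A \<and> card A \<le> 2 ^ (b + 2 * L) \<and> CT D (enc_set A) (n2s w) \<le> C * e
        \<and> KC D (enc_set A) [] \<le> f b + C * L)"
proof -
  obtain c1 where c1: "\<And>t Q e L N S l b. K (run (covered (threshold Q e L) N S l) N t div 2 ^ b * 2 ^ (b + S) - 1)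
    \<le> blen (changes (\<lambda>t. run (covered (threshold Q e L) N S l) N t div 2 ^ b) t)
      + 2 * (blen Q + blen e + blen L + blen N + blen S + blen l + blen b) + c1"
    by (rule K_node) (rule that)
  obtain c2 where c2: "\<And>B w. K (cone B w) \<le> K w + 2 * blen B + c2" by (rule K_cone) (rule that)
  obtain c3 where c3: "\<And>B w. CT D (n2s (cone B w)) (n2s w) \<le> 2 * blen B + c3" by (rule CT_cone) (rule that)
  obtain c4 where c4: "\<And>w. K (Suc w) \<le> K w + c4" by (rule K_Suc) (rule that)
  define C where "C = 40 + c1 + c2 + c3 + c4"
  show thesis
  proof (rule that[of C])
    fix n k e L f
    assume pp: "profile_params n k e L f"
    interpret p: profile_params n k e L f by (rule pp)
    define N S l Q where "N = p.N" and "S = p.S" and "l = p.l" and "Q = p.Q"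
    note defs = Q_def N_def S_def l_def
    let ?g = "threshold Q e L"
    let ?C = "covered ?g N S l"
    have full_M: "card (full l S t) \<le> p.M" for t
      using p.full_le_M[OF full_bounds(2)] unfolding defs .
    have g_M: "(2 ^ ?g b - 1) * 2 ^ b \<le> p.M" if "b \<le> N" for b
      using p.g_le_M that unfolding defs .
    have game: "game N ?C (Psi ?g N S l)"
      by (rule game_covered[OF _ g_M full_M]) (use p.M_le in \<open>simp add: defs\<close>)
    obtain T where T: "\<And>t. \<not> ?C t (run ?C N T)"
      by (rule uncovered_leaf[OF game full_M g_M]) (assumption, rule that)
    define v where "v = run ?C N T"
    have v: "\<not> ?C t v" for t unfolding v_def by (rule T)
    have "v div 2 ^ N = 1" unfolding v_def by (rule game.run_range[OF game])
    then have v_range: "2 ^ N \<le> v" "v < 2 ^ Suc N" "0 < v"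
      by (metis div_less not_le zero_neq_one, metis One_nat_def div_less_iff_less_mult less_2_cases_iff power_Suc zero_less_power pos2, metis div_0 gr0I zero_neq_one)
    have e1: "1 \<le> e" "1 \<le> L" using p.e_pos p.L_pos by simp_all
    have Ce: "x \<le> x * e" "x \<le> x * L" for x using e1 by simp_all

    \<comment> \<open>This is the first extension of the leaf. \<open>2 * blen Q\<close> is at most
      \<open>2 * L + 2 * e\<close>, and \<open>q\<close> has saved the \<open>2 * L\<close>; if
      \<open>k < 2 * L\<close>, then \<open>Q = 0\<close>.\<close>
    have start: "K (v * 2 ^ S - 1) \<le> k + 20 * e + c1 * e"
    proof -
      have "K (run ?C N T div 2 ^ 0 * 2 ^ (0 + S) - 1) \<le> (k - 2 * L) + 2 * blen Q + 15 * e + 3 + c1"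
        by (rule K_run[OF c1 pp defs]) (auto simp: p.leaf_full[OF full_bounds(2)] defs intro!: p.leaf_weight[simplified] p.leaf_full[OF full_bounds(2), simplified])
      then have "K (v * 2 ^ S - 1) \<le> (k - 2 * L) + 2 * blen Q + 15 * e + 3 + c1"
        by (simp add: v_def)
      moreover have "(k - 2 * L) + 2 * blen Q \<le> k + 2 * e"
        using p.blen_Q p.Q_eq_0 by (cases "k < 2 * L") (auto simp: Q_def)
      then have "(k - 2 * L) + 2 * blen Q + 15 * e + 3 + c1 \<le> k + 20 * e + c1 * e"
        using e1 Ce(1)[of c1] by linarith
      ultimately show ?thesis by (rule le_trans)
    qed
    txt \<open>Consecutive numbers have almost equal complexity, so the first extension of the leaf whose
      complexity reaches \<open>l\<close> does not exceed it by more than a constant.\<close>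
    let ?P = "\<lambda>r. l \<le> K (v * 2 ^ S + r - 1)"
    obtain r0 where r0: "r0 < 2 ^ S" "?P r0" using uncovered_extension[OF v v_range(3)] by blast
    define r where "r = (LEAST r. ?P r)"
    have r: "?P r" "r \<le> r0" unfolding r_def by (rule LeastI[of ?P], rule r0, rule Least_le, rule r0)
    define w where "w = v * 2 ^ S + r - 1"
    have w1: "w + 1 = v * 2 ^ S + r" using v_range by (simp add: w_def Suc_leI)
    have wv: "(w + 1) div 2 ^ S = v" unfolding w1 using r r0 by simp
    have up: "K w \<le> k + 20 * e + c1 * e + c4 * e"
    proof (cases r)
      case 0 then show ?thesis using start by (simp add: w_def)
    next
      case (Suc s)
      define y where "y = K (v * 2 ^ S + s - 1)"
      have "\<not> l \<le> y" using not_less_Least[of s ?P] Suc unfolding r_def y_def by simp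
      moreover have "w = Suc (v * 2 ^ S + s - 1)" using v_range Suc by (simp add: w_def Suc_leI)
      then have "K w \<le> y + c4" unfolding y_def using c4 by (simp only:)
      ultimately show ?thesis using Ce(1)[of c4] unfolding l_def p.l_def by linarith
    qed
    have low: "k \<le> K w + 3 * e" using r(1) by (simp add: w_def l_def p.l_def)
    have w_range: "2 ^ n \<le> w + 1" "w + 1 < 2 ^ Suc n"
    proof -
      have nNS: "n = N + S" using p.S_N by (simp add: defs)
      have "2 ^ N * 2 ^ S \<le> v * 2 ^ S" using v_range(1) by (rule mult_le_mono1)
      then show "2 ^ n \<le> w + 1" unfolding w1 nNS power_add by linarith
      have "Suc v * 2 ^ S \<le> 2 ^ Suc N * 2 ^ S" using v_range(2) by (intro mult_le_mono1) simp
      then show "w + 1 < 2 ^ Suc n" unfolding w1 nNS using r r0 by (simp add: power_add)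
    qed
    have avoid: "f b \<le> KC D (enc_set A) [] + 6 * L" if A: "finite A" "n2s w \<in> A" "card A \<le> 2 ^ b" for A b
    proof (cases "b \<le> N")
      case True
      then have "?g b \<le> KC D (enc_set A) []" using uncovered_K[OF v v_range(3) wv A] by simp
      then show ?thesis using p.f_le_g[of b] True by (simp add: defs)
    next
      case False
      \<comment> \<open>The game controls no sizes above \<open>2 ^ N\<close>, but there
        \<open>f\<close> has come down to at most \<open>n - N = S\<close>.\<close>
      have "f b \<le> 2 * L"
      proof (cases "b \<le> n")
        case True then show ?thesis using p.f_le_diff[OF True] p.S_N False by (simp add: defs)
      next
        case False then show ?thesis using p.f_anti[of n b] p.f_n by simp
      qed
      then show ?thesis by simp
    qed
    have model: "\<exists>A. finite A \<and> n2s w \<in> A \<and> card A \<le> 2 ^ (b + 2 * L) \<and> CT D (enc_set A) (n2s w) \<le> 2 * e + c3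
        \<and> KC D (enc_set A) [] \<le> f b + 30 * L + c1 + c2" for b
    proof -
      \<comment> \<open>The \<open>S\<close> free bits lie below every node, so the cone has
        \<open>2 ^ (a + S)\<close> elements; hence the \<open>2 * L\<close> in the bound on
        \<open>card A\<close>.\<close>
      define a where "a = min b N"
      let ?B = "a + S"
      have a: "a \<le> N" "a \<le> b" "f a \<le> f b + 2 * L" using p.f_min_N[of b] by (auto simp: a_def N_def)
      have Bn: "?B \<le> n" using a p.S_N by (simp add: defs)
      then have "(2::nat) ^ ?B \<le> 2 ^ n" by (intro power_increasing) auto
      then have "2 ^ ?B \<le> w + 1" using w_range by linarith
      then obtain A where A: "finite A" "n2s w \<in> A" "card A = 2 ^ ?B" "enc_set A = n2s (cone ?B w)"
        by (rule cone_enc)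
      let ?u = "v div 2 ^ a * 2 ^ ?B - 1"
      have "K ?u \<le> (f a + L) + 2 * blen Q + 15 * e + 3 + c1"
        unfolding v_def
        by (rule K_run[OF c1 pp defs a(1)]) (auto simp: defs intro!: p.node_weight[simplified] p.node_full[OF full_bounds(2)] a(1)[unfolded defs])
      moreover have "blen Q \<le> L + e" using p.blen_Q by (simp add: Q_def)
      ultimately have u: "K ?u \<le> f b + 25 * L + c1" using a(3) p.L(2) p.e_pos by linarith
      \<comment> \<open>The model is computed totally from \<open>w\<close>, but its complexity is
        bounded through \<open>?u\<close>, the representative of the same node, whose complexity
        \<open>K_run\<close> controls.\<close>
      have "cone ?B w = cone ?B ?u"
      proof -
        have "(w + 1) div 2 ^ ?B = v div 2 ^ a"
          unfolding wv[symmetric] div_mult2_eq[symmetric] power_add[symmetric] by (simp add: add.commute)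
        moreover have "(?u + 1) div 2 ^ ?B = v div 2 ^ a"
        proof -
          have "2 ^ a \<le> v" using v_range(1) a(1) by (meson le_trans one_le_numeral power_increasing)
          then have "0 < v div 2 ^ a" by (simp add: div_greater_zero_iff)
          then have "?u + 1 = v div 2 ^ a * 2 ^ ?B" by (simp add: Suc_leI)
          then show ?thesis by simp
        qed
        ultimately show ?thesis by (simp add: cone_def)
      qed
      then have "KC D (enc_set A) [] \<le> K ?u + 2 * blen ?B + c2" using c2[of ?B ?u] A(4) by simp
      moreover have "blen ?B \<le> e" using Bn by (intro p.blen_le) simp
      ultimately have "KC D (enc_set A) [] \<le> f b + 30 * L + c1 + c2" using u p.L(2) by linarith
      moreover have "CT D (enc_set A) (n2s w) \<le> 2 * e + c3"
        using c3[of ?B w] \<open>blen ?B \<le> e\<close> A(4) by simp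
      moreover have "card A \<le> 2 ^ (b + 2 * L)"
        unfolding A(3) using a p.S_N by (intro power_increasing) (auto simp: defs)
      ultimately show ?thesis using A by blast
    qed
    have C_e: "20 * e + c1 * e + c4 * e \<le> C * e" "3 * e \<le> C * e" "2 * e + c3 \<le> C * e"
      and C_L: "6 * L \<le> C * L" "30 * L + c1 + c2 \<le> C * L"
      using Ce(1)[of c3] Ce(2)[of c1] Ce(2)[of c2] unfolding C_def distrib_right by linarith+
    show "\<exists>w. 2 ^ n \<le> w + 1 \<and> w + 1 < 2 ^ Suc n
      \<and> k \<le> K w + C * e \<and> K w \<le> k + C * e
      \<and> (\<forall>A b. finite A \<longrightarrow> n2s w \<in> A \<longrightarrow> card A \<le> 2 ^ b \<longrightarrow> f b \<le> KC D (enc_set A) [] + C * L)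
      \<and> (\<forall>b. \<exists>A. finite A \<and> n2s w \<in> A \<and> card A \<le> 2 ^ (b + 2 * L) \<and> CT D (enc_set A) (n2s w) \<le> C * e
          \<and> KC D (enc_set A) [] \<le> f b + C * L)"
    proof (intro exI[of _ w] conjI allI impI)
      show "k \<le> K w + C * e" "K w \<le> k + C * e" using low up C_e by linarith+
      show "f b \<le> KC D (enc_set A) [] + C * L" if "finite A" "n2s w \<in> A" "card A \<le> 2 ^ b" for A b
        using avoid[OF that] C_L by linarith
      show "\<exists>A. finite A \<and> n2s w \<in> A \<and> card A \<le> 2 ^ (b + 2 * L) \<and> CT D (enc_set A) (n2s w) \<le> C * e
          \<and> KC D (enc_set A) [] \<le> f b + C * L" for b
      proof -
        obtain A where "finite A" "n2s w \<in> A" "card A \<le> 2 ^ (b + 2 * L)"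
          "CT D (enc_set A) (n2s w) \<le> 2 * e + c3" "KC D (enc_set A) [] \<le> f b + 30 * L + c1 + c2"
          using model by blast
        with C_e C_L show ?thesis by (intro exI[of _ A] conjI) linarith+
      qed
    qed (fact w_range)+
  qed
qed

end

section \<open>From the set \<open>P\<close> to the parameters, and estimates in terms of log
  n\<close>

lemma profile_params_boundary:
  assumes n: "2 \<le> n" and up: "upward_closed P" and P: "(0, n) \<in> P" "(k, 0) \<in> P"
    and slope: "\<forall>a b c'. (a, b + c') \<in> P \<longrightarrow> (a + c', b) \<in> P"
    and ge: "\<forall>a b. (a, b) \<in> P \<longrightarrow> k \<le> a + b"
  defines "f \<equiv> \<lambda>b. LEAST a. (a, b) \<in> P"
  shows "(a, b) \<in> P \<longleftrightarrow> f b \<le> a"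
    and "profile_params n k (Suc (blen n)) (LEAST L. n * Suc (blen n) \<le> L * L) f"
proof -
  have upD: "(a', b') \<in> P" if "(a, b) \<in> P" "a \<le> a'" "b \<le> b'" for a a' b b'
    using up that unfolding upward_closed_def by blast
  have mem: "(f b, b) \<in> P" for b
    unfolding f_def by (rule LeastI[where P = "\<lambda>a. (a, b) \<in> P", OF upD[OF P(2), of k]]) simp_all
  have le: "f b \<le> a" if "(a, b) \<in> P" for a b
    unfolding f_def using that by (rule Least_le)
  show "(a, b) \<in> P \<longleftrightarrow> f b \<le> a"
    using le upD[OF mem, of b a b] by blast
  define e where "e = Suc (blen n)"
  define L where "L = (LEAST L. n * e \<le> L * L)"
  have en: "e \<le> n"
  proof (rule ccontr)
    assume "\<not> e \<le> n"
    then have "(2::nat) ^ n \<le> 2 ^ blen n" unfolding e_def by (intro power_increasing) auto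
    then have "2 ^ n \<le> n + 1" using length_n2s[of n] by linarith
    moreover have "n + 1 < 2 ^ n" using n
    proof (induction n rule: dec_induct)
      case (step n) then show ?case by simp
    qed simp
    ultimately show False by simp
  qed
  have L: "n * e \<le> L * L" "L \<le> n"
    unfolding L_def by (rule LeastI[of "\<lambda>L. n * e \<le> L * L" n], simp add: en, rule Least_le, simp add: en)
  have "e * e \<le> L * L" using L(1) mult_le_mono1[OF en, of e] by linarith
  then have eL: "e \<le> L" by (simp add: power2_eq_square[symmetric])
  have "profile_params n k e L f"
  proof
    show "k \<le> n" using ge P(1) by fastforce
    show "f b \<le> k" for b using le upD[OF P(2), of k b] by simp
    show "f b' \<le> f b" if "b \<le> b'" for b b' using le upD[OF mem[of b], of "f b" b'] that by simp
    show "f b \<le> f (b + d) + d" for b d by (rule le[OF slope[rule_format, OF mem]])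
    show "k \<le> f b + b" for b using ge mem by blast
    show "f n = 0" using le[OF P(1)] by simp
  qed (use n L eL e_def in auto)
  then show "profile_params n k (Suc (blen n)) (LEAST L. n * Suc (blen n) \<le> L * L) f"
    unfolding L_def e_def .
qed

lemma blen_le_log:
  assumes "2 \<le> n"
  shows "real (Suc (blen n)) \<le> 3 * log 2 (real n)"
proof -
  have "2 ^ blen n \<le> n + 1" using length_n2s[of n] by simp
  also have "n + 1 \<le> n * n" using assms mult_le_mono1[of 2 n n] by linarith
  finally have "real (2 ^ blen n) \<le> real (n * n)" by (simp only: of_nat_le_iff)
  then have "log 2 (2 ^ blen n) \<le> log 2 (real n * real n)" using assms by (intro log_mono) auto
  then have "real (blen n) \<le> 2 * log 2 (real n)" using assms by (simp add: log_mult log_nat_power)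
  moreover have "1 \<le> log 2 (real n)" using assms by (simp add: le_log_iff)
  ultimately show ?thesis by simp
qed

text \<open>With \<open>m = n * Suc (blen n)\<close>, minimality gives
  \<open>L - 1 \<le> sqrt m\<close>, so \<open>L \<le> 2 * sqrt m\<close>; and \<open>m\<close> is
  at most 4 n log n.\<close>

lemma Least_square_le:
  assumes "2 \<le> n"
  shows "real (LEAST L. n * Suc (blen n) \<le> L * L) \<le> 4 * sqrt (real n * log 2 (real n))"
proof -
  define m where "m = n * Suc (blen n)"
  define L where "L = (LEAST L. m \<le> L * L)"
  have log1: "1 \<le> log 2 (real n)" using assms by (simp add: le_log_iff)
  have m1: "1 \<le> m" unfolding m_def using assms by simp
  have "L \<noteq> 0"
  proof
    assume "L = 0"
    moreover have "m \<le> L * L" unfolding L_def by (rule LeastI[of _ m]) (simp add: m1)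
    ultimately show False using m1 by simp
  qed
  then have "\<not> m \<le> (L - 1) * (L - 1)" unfolding L_def by (intro not_less_Least) simp
  then have "(L - 1) * (L - 1) \<le> m" by linarith
  then have "real ((L - 1) * (L - 1)) \<le> real m" by (simp only: of_nat_le_iff)
  then have "(real L - 1)\<^sup>2 \<le> real m" using \<open>L \<noteq> 0\<close> by (simp add: power2_eq_square of_nat_diff)
  then have "real L - 1 \<le> sqrt (real m)" by (rule real_le_rsqrt)
  moreover have "1 \<le> sqrt (real m)" using m1 by simp
  moreover have "sqrt (real m) \<le> sqrt (4 * (real n * log 2 (real n)))"
  proof (rule real_sqrt_le_mono)
    have "real m \<le> real n * (3 * log 2 (real n))"
      unfolding m_def of_nat_mult using blen_le_log[OF assms] by (intro mult_left_mono) auto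
    also have "\<dots> \<le> 4 * (real n * log 2 (real n))" using log1 by simp
    finally show "real m \<le> 4 * (real n * log 2 (real n))" .
  qed
  moreover have "sqrt (4 * (real n * log 2 (real n))) = 2 * sqrt (real n * log 2 (real n))"
    by (simp add: real_sqrt_mult)
  ultimately show ?thesis unfolding L_def m_def by linarith
qed

lemma log_card_le_iff:
  assumes "finite A" "x \<in> A"
  shows "log 2 (real (card A)) \<le> real b \<longleftrightarrow> card A \<le> 2 ^ b"
proof -
  have "0 < card A" using assms by (auto simp: card_gt_0_iff)
  then have "log 2 (real (card A)) \<le> real b \<longleftrightarrow> real (card A) \<le> 2 powr real b"
    by (simp add: log_le_iff)
  also have "\<dots> \<longleftrightarrow> real (card A) \<le> real (2 ^ b)" by (simp add: powr_realpow)
  finally show ?thesis by (simp only: of_nat_le_iff)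
qed

theorem theorem6:
  fixes D :: "bool list \<Rightarrow> bool list \<Rightarrow> bool list option"
  assumes "universal D"
  shows "\<exists>c::real. \<forall>(n::nat) (k::nat) (P::(nat \<times> nat) set).
     n \<ge> 2 \<and> upward_closed P \<and> (0, n) \<in> P \<and> (k, 0) \<in> P
     \<and> (\<forall>a b c'. (a, b + c') \<in> P \<longrightarrow> (a + c', b) \<in> P)
     \<and> (\<forall>a b. (a, b) \<in> P \<longrightarrow> a + b \<ge> k)
     \<longrightarrow> (\<exists>x::bool list. length x = n
           \<and> \<bar>real (KC D x []) - real k\<bar> \<le> c * log 2 (real n)
           \<and> normal D (c * log 2 (real n)) (c * sqrt (real n * log 2 (real n))) x
           \<and> close (real (KC D (enc_bnd P) []) + c * sqrt (real n * log 2 (real n))) (profile D x) P)"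
proof -
  obtain Dn where "kolmogorov D Dn" using ex_kolmogorov[OF assms] by (elim exE)
  then interpret kolmogorov D Dn .
  obtain C where C: "\<And>n k e L f. profile_params n k e L f \<Longrightarrow> \<exists>w. 2 ^ n \<le> w + 1 \<and> w + 1 < 2 ^ Suc n
    \<and> k \<le> K w + C * e \<and> K w \<le> k + C * e
    \<and> (\<forall>A b. finite A \<longrightarrow> n2s w \<in> A \<longrightarrow> card A \<le> 2 ^ b \<longrightarrow> f b \<le> KC D (enc_set A) [] + C * L)
    \<and> (\<forall>b. \<exists>A. finite A \<and> n2s w \<in> A \<and> card A \<le> 2 ^ (b + 2 * L) \<and> CT D (enc_set A) (n2s w) \<le> C * e
        \<and> KC D (enc_set A) [] \<le> f b + C * L)"
    by (rule ex_string) (rule that)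
  \<comment> \<open>Multiples of \<open>L\<close> up to \<open>2 * Suc C\<close> occur, and
    \<open>L\<close> is at most 4 times the square root; for the multiples of \<open>e\<close> the
    factor \<open>3 * C\<close> is enough.\<close>
  define c :: real where "c = 8 * real (Suc C)"
  show ?thesis
  proof (intro exI[of _ c] allI impI, elim conjE)
    fix n k :: nat and P :: "(nat \<times> nat) set"
    assume n: "2 \<le> n" and P: "upward_closed P" "(0, n) \<in> P" "(k, 0) \<in> P"
      "\<forall>a b c'. (a, b + c') \<in> P \<longrightarrow> (a + c', b) \<in> P" "\<forall>a b. (a, b) \<in> P \<longrightarrow> k \<le> a + b"
    define e where "e = Suc (blen n)"
    define L where "L = (LEAST L. n * e \<le> L * L)"
    define f where "f b = (LEAST a. (a, b) \<in> P)" for b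
    have iff: "(a, b) \<in> P \<longleftrightarrow> f b \<le> a" for a b
      unfolding f_def by (rule profile_params_boundary[OF n P])
    have "profile_params n k e L f"
      unfolding f_def[abs_def] e_def L_def by (rule profile_params_boundary[OF n P])
    from C[OF this] obtain w where w': "2 ^ n \<le> w + 1 \<and> w + 1 < 2 ^ Suc n
      \<and> k \<le> K w + C * e \<and> K w \<le> k + C * e
      \<and> (\<forall>A b. finite A \<longrightarrow> n2s w \<in> A \<longrightarrow> card A \<le> 2 ^ b \<longrightarrow> f b \<le> KC D (enc_set A) [] + C * L)
      \<and> (\<forall>b. \<exists>A. finite A \<and> n2s w \<in> A \<and> card A \<le> 2 ^ (b + 2 * L) \<and> CT D (enc_set A) (n2s w) \<le> C * e
          \<and> KC D (enc_set A) [] \<le> f b + C * L)"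
      by (rule exE)
    note w = w'[THEN conjunct1] w'[THEN conjunct2, THEN conjunct1]
      w'[THEN conjunct2, THEN conjunct2, THEN conjunct1]
      w'[THEN conjunct2, THEN conjunct2, THEN conjunct2, THEN conjunct1]
      w'[THEN conjunct2, THEN conjunct2, THEN conjunct2, THEN conjunct2, THEN conjunct1, rule_format]
      w'[THEN conjunct2, THEN conjunct2, THEN conjunct2, THEN conjunct2, THEN conjunct2, rule_format]
    let ?x = "n2s w" and ?l = "log 2 (real n)" and ?d = "sqrt (real n * log 2 (real n))"
    have log1: "1 \<le> ?l" using n by (simp add: le_log_iff)
    have e3: "real e \<le> 3 * ?l" unfolding e_def by (rule blen_le_log[OF n])
    have L4: "real L \<le> 4 * ?d" unfolding L_def e_def by (rule Least_square_le[OF n])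
    have e: "real m * real e \<le> c * ?l" if "m \<le> C" for m
    proof -
      have "real m * real e \<le> real C * (3 * ?l)"
        by (rule mult_mono[OF _ e3]) (use that in simp_all)
      also have "\<dots> \<le> c * ?l" using log1 by (simp add: c_def)
      finally show ?thesis .
    qed
    have L: "real m * real L \<le> c * ?d" if "m \<le> 2 * Suc C" for m
    proof -
      have "real m * real L \<le> real (2 * Suc C) * (4 * ?d)"
        by (rule mult_mono[OF _ L4]) (use that in \<open>simp_all only: of_nat_le_iff of_nat_0_le_iff\<close>)
      also have "\<dots> = c * ?d" by (simp add: c_def)
      finally show ?thesis .
    qed
    have below: "f b \<le> a + C * L" if "(a, b) \<in> profile D ?x" for a b
    proof -
      have "\<exists>A. finite A \<and> ?x \<in> A \<and> KC D (enc_set A) [] \<le> a \<and> log 2 (real (card A)) \<le> real b"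
        using that unfolding profile_def mem_Collect_eq prod.case .
      then obtain A where A: "finite A" "?x \<in> A" "KC D (enc_set A) [] \<le> a" "log 2 (real (card A)) \<le> real b"
        by (elim exE conjE)
      have "card A \<le> 2 ^ b" using A(4) unfolding log_card_le_iff[OF A(1,2)] .
      from w(5)[OF A(1,2) this] A(3) show ?thesis by linarith
    qed
    show "\<exists>x. length x = n \<and> \<bar>real (KC D x []) - real k\<bar> \<le> c * ?l \<and> normal D (c * ?l) (c * ?d) x
       \<and> close (real (KC D (enc_bnd P) []) + c * ?d) (profile D x) P"
    proof (intro exI[of _ ?x] conjI)
      show "length ?x = n" using w(1,2) by (rule length_n2s_eq)
      have "real (K w) \<le> real (k + C * e)" "real k \<le> real (K w + C * e)"
        using w(3,4) by (simp_all only: of_nat_le_iff)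
      then show "\<bar>real (K w) - real k\<bar> \<le> c * ?l" using e[of C] by (simp add: abs_le_iff)
      \<comment> \<open>One cone for \<open>b\<close> serves all \<open>a\<close>: its complexity
        exceeds \<open>f b\<close> by at most \<open>C * L\<close>, and \<open>below\<close> bounds
        \<open>f b\<close> by \<open>a + C * L\<close>.\<close>
      show "normal D (c * ?l) (c * ?d) ?x"
        unfolding normal_def
      proof (intro allI impI)
        fix a b assume ab: "(a, b) \<in> profile D ?x"
        obtain A where A: "finite A" "?x \<in> A" "card A \<le> 2 ^ (b + 2 * L)" "CT D (enc_set A) ?x \<le> C * e"
          "KC D (enc_set A) [] \<le> f b + C * L" using w(6)[of b] by (elim exE conjE)
        have "KC D (enc_set A) [] \<le> a + 2 * C * L" using A(5) below[OF ab] by simp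
        then have "real (KC D (enc_set A) []) \<le> real a + real (2 * C) * real L"
          by (metis of_nat_add of_nat_le_iff of_nat_mult)
        then have "real (KC D (enc_set A) []) \<le> real a + c * ?d" using L[of "2 * C"] by simp
        moreover have "log 2 (real (card A)) \<le> real (b + 2 * L)" using A(3) unfolding log_card_le_iff[OF A(1,2)] .
        then have "log 2 (real (card A)) \<le> real b + c * ?d" using L[of 2] by simp
        moreover have "real (CT D (enc_set A) ?x) \<le> real (C * e)" using A(4) by (simp only: of_nat_le_iff)
        then have "real (CT D (enc_set A) ?x) \<le> c * ?l" using e[of C] by simp
        ultimately show "in_strong_profile D (c * ?l) ?x (real a + c * ?d) (real b + c * ?d)"
          unfolding in_strong_profile_def using A(1,2) by (intro exI[of _ A] conjI)
      qed
      show "close (real (KC D (enc_bnd P) []) + c * ?d) (profile D ?x) P"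
        unfolding close_def
      proof (intro conjI ballI, safe)
        fix a b assume "(a, b) \<in> profile D ?x"
        then have "(a + C * L, b) \<in> P" using below iff by simp
        moreover have "real C * real L \<le> c * ?d" "0 \<le> c * ?d" using L[of C] L[of 0] by simp_all
        ultimately show "\<exists>(a', b')\<in>P. \<bar>real a - real a'\<bar> \<le> real (KC D (enc_bnd P) []) + c * ?d
            \<and> \<bar>real b - real b'\<bar> \<le> real (KC D (enc_bnd P) []) + c * ?d"
          by (intro bexI[of _ "(a + C * L, b)"]) auto
      next
        fix a b assume "(a, b) \<in> P"
        then have "f b \<le> a" using iff by simp
        moreover obtain A where A: "finite A" "?x \<in> A" "card A \<le> 2 ^ (b + 2 * L)"
          "KC D (enc_set A) [] \<le> f b + C * L" using w(6)[of b] by (elim exE conjE)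
        ultimately have "KC D (enc_set A) [] \<le> a + C * L" by simp
        moreover have "log 2 (real (card A)) \<le> real (b + 2 * L)" using A(3) unfolding log_card_le_iff[OF A(1,2)] .
        ultimately have "(a + C * L, b + 2 * L) \<in> profile D ?x"
          unfolding profile_def mem_Collect_eq prod.case using A(1,2) by (intro exI[of _ A] conjI)
        moreover have "real C * real L \<le> c * ?d" "2 * real L \<le> c * ?d" using L[of C] L[of 2] by simp_all
        ultimately show "\<exists>(a', b')\<in>profile D ?x. \<bar>real a - real a'\<bar> \<le> real (KC D (enc_bnd P) []) + c * ?d
            \<and> \<bar>real b - real b'\<bar> \<le> real (KC D (enc_bnd P) []) + c * ?d"
          by (intro bexI[of _ "(a + C * L, b + 2 * L)"]) auto
      qed
    qed
  qed
qed

end
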